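(* Let $X$ be a non-negative càdlàg submartingale on $[0,T]$ started at a constant $X_0>0$, and let $p\in(0,1)$. Denote $m_r:=X_0^{-r}\,\mathbb{E}[X_T^r]$ for $r\le1$. Then: (i) there is a unique $\hat\alpha\in(0,1]$ which solves $$m_p\,\hat\alpha^{-p}=\frac{1-p+p\,m_1}{1-p+p\,\hat\alpha},$$ and for this $\hat\alpha$ we have $$\mathbb{E}[\bar X_T^p]\ \overset{(a)}{\le}\ X_0^p\,m_p\,\hat\alpha^{-p}=\frac{X_0^p}{1-p+p\hat\alpha}+X_0^{p-1}\frac{p}{1-p+p\hat\alpha}\big(\mathbb{E}[X_T]-X_0\big)$$ $$\overset{(b)}{<}\ \frac{X_0^p}{1-p}+X_0^{p-1}\frac{p}{1-p}\big(\mathbb{E}[X_T]-X_0\big).$$ (ii) There exists a martingale which attains equality in (a). Further, for every $\epsilon>0$ there exists a martingale $X$ such that $$0\le\frac{X_0^p}{1-p}+X_0^{p-1}\frac p{1-p}\big(\mathbb{E}[X_T]-X_0\big)-\mathbb{E}[\bar X_T^p]<\epsilon .$$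
   Context: $T>0$ is a fixed time horizon; the underlying probability space supports a standard Brownian motion. Martingales and submartingales are with respect to their own natural filtration; $\bar X_T:=\sup_{t\le T}X_t$. The martingales in (ii) are non-negative and start at the given $X_0>0$. *)

theory Defs
  imports "HOL-Probability.Probability"
begin

text \<open>
  Processes are functions of time and outcome. Only times in \<open>{0..T}\<close> matter for processes
  with horizon \<open>T\<close>. In \<open>nonneg_cadlag_from\<close> the conditions hold at every
  outcome, whereas Brownian paths need only be continuous almost surely.
\<close>

definition natural_filtration ::
    "'a measure \<Rightarrow> (real \<Rightarrow> 'a \<Rightarrow> real) \<Rightarrow> real \<Rightarrow> 'a measure" where
  "natural_filtration M X t =
     sigma (space M) (\<Union>s\<in>{0..t}. {X s -` A \<inter> space M | A. A \<in> sets borel})"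

text \<open>Adaptedness is automatic, since the filtration is the one generated by the process.\<close>

definition martingale_on :: "'a measure \<Rightarrow> real \<Rightarrow> (real \<Rightarrow> 'a \<Rightarrow> real) \<Rightarrow> bool" where
  "martingale_on M T X \<longleftrightarrow>
     (\<forall>t\<in>{0..T}. integrable M (X t)) \<and>
     (\<forall>s t. 0 \<le> s \<longrightarrow> s \<le> t \<longrightarrow> t \<le> T \<longrightarrow>
        (AE \<omega> in M. real_cond_exp M (natural_filtration M X s) (X t) \<omega> = X s \<omega>))"

definition submartingale_on :: "'a measure \<Rightarrow> real \<Rightarrow> (real \<Rightarrow> 'a \<Rightarrow> real) \<Rightarrow> bool" where
  "submartingale_on M T X \<longleftrightarrow>
     (\<forall>t\<in>{0..T}. integrable M (X t)) \<and>
     (\<forall>s t. 0 \<le> s \<longrightarrow> s \<le> t \<longrightarrow> t \<le> T \<longrightarrow>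
        (AE \<omega> in M. X s \<omega> \<le> real_cond_exp M (natural_filtration M X s) (X t) \<omega>))"

definition cadlag_on :: "real \<Rightarrow> (real \<Rightarrow> real) \<Rightarrow> bool" where
  "cadlag_on T f \<longleftrightarrow>
     (\<forall>t\<in>{0..<T}. (f \<longlongrightarrow> f t) (at_right t)) \<and>
     (\<forall>t\<in>{0<..T}. \<exists>l. (f \<longlongrightarrow> l) (at_left t))"

definition nonneg_cadlag_from ::
    "'a measure \<Rightarrow> real \<Rightarrow> real \<Rightarrow> (real \<Rightarrow> 'a \<Rightarrow> real) \<Rightarrow> bool" where
  "nonneg_cadlag_from M T x0 X \<longleftrightarrow>
     (\<forall>\<omega>\<in>space M. X 0 \<omega> = x0 \<and> (\<forall>t\<in>{0..T}. 0 \<le> X t \<omega>) \<and> cadlag_on T (\<lambda>t. X t \<omega>))"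

text \<open>The supremum is a genuine one for cadlag paths, which are bounded on \<open>{0..T}\<close>.\<close>

definition running_max :: "(real \<Rightarrow> 'a \<Rightarrow> real) \<Rightarrow> real \<Rightarrow> 'a \<Rightarrow> real" where
  "running_max X T \<omega> = (SUP t\<in>{0..T}. X t \<omega>)"

definition norm_moment ::
    "'a measure \<Rightarrow> real \<Rightarrow> real \<Rightarrow> (real \<Rightarrow> 'a \<Rightarrow> real) \<Rightarrow> real \<Rightarrow> real" where
  "norm_moment M T x0 X r = x0 powr (- r) * (\<integral>\<omega>. X T \<omega> powr r \<partial>M)"

definition standard_brownian_motion :: "'a measure \<Rightarrow> (real \<Rightarrow> 'a \<Rightarrow> real) \<Rightarrow> bool" where
  "standard_brownian_motion M W \<longleftrightarrow>
     prob_space M \<and>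
     (\<forall>t\<ge>0. W t \<in> borel_measurable M) \<and>
     (AE \<omega> in M. W 0 \<omega> = 0) \<and>
     (\<forall>s t. 0 \<le> s \<longrightarrow> s < t \<longrightarrow>
        distributed M lborel (\<lambda>\<omega>. W t \<omega> - W s \<omega>) (normal_density 0 (sqrt (t - s)))) \<and>
     (\<forall>(n::nat) (\<tau>::nat \<Rightarrow> real). 0 \<le> \<tau> 0 \<longrightarrow> (\<forall>i<n. \<tau> i \<le> \<tau> (Suc i)) \<longrightarrow>
        prob_space.indep_vars M (\<lambda>_. borel) (\<lambda>i \<omega>. W (\<tau> (Suc i)) \<omega> - W (\<tau> i) \<omega>) {..<n}) \<and>
     (AE \<omega> in M. continuous_on {0..} (\<lambda>t. W t \<omega>))"

end

theory Submission
  imports Defs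
begin

text \<open>
  Write \<open>\<phi>(x, y) = (1 - p) y^p + p x y^(p-1)\<close> for the tangent of the concave function
  \<open>x^p\<close> at \<open>y\<close>, evaluated at \<open>x\<close>. If \<open>x\<^sub>i\<close> is a non-negative sequence with running maximum \<open>y\<^sub>i\<close>, then
  \<open>\<phi>(x\<^sub>i, y\<^sub>i)\<close> changes in one step by at most the slope \<open>p y\<^sub>i^(p-1)\<close> times the
  increment of \<open>x\<close> (\<open>powr_tangent_path_le\<close>). The slopes decrease along the path and
  depend only on the past, so for a submartingale replacing them by the initial slope can only increase the expectation,
  because \<open>\<integral> Z (X\<^sub>t - X\<^sub>s) \<ge> 0\<close> for every bounded non-negative \<open>Z\<close> known at time \<open>s\<close>. Hence
  \<open>E \<phi>(X\<^sub>T, Y) \<le> x0^p (1 - p + p m\<^sub>1)\<close>, where \<open>Y\<close> is the maximum over a finite grid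
  and \<open>m\<^sub>r\<close> is the normalised moment of order \<open>r\<close> (\<open>integral_powr_tangent_max_le\<close>).

  Bounding \<open>X\<^sub>T / Y\<close> below by means of the tangent of \<open>r^p\<close> at a free parameter \<open>b\<close> turns this
  into \<open>(1 - p) (1 - b) E Y^p \<le> x0^p (1 - p + p m\<^sub>1) - b^(1-p) E X\<^sub>T^p\<close>
  (\<open>powr_tangent_ge_mix\<close>). The defining equation of \<open>\<alpha>\<close> says \<open>1 - p + p m\<^sub>1 = m\<^sub>p g(\<alpha>)\<close> with the strictly
  decreasing function \<open>g = moment_profile p\<close>. This gives existence and uniqueness of \<open>\<alpha>\<close>, and
  for \<open>b < \<alpha>\<close> it makes the right-hand side at most the value for which \<open>(1 - p) (1 - b)\<close>
  cancels, leaving \<open>E Y^p \<le> x0^p m\<^sub>p b^(-p)\<close>. Letting \<open>b\<close> increase to \<open>\<alpha>\<close> proves the maximal inequality on the grid, also when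
  \<open>\<alpha> = 1\<close>. Cadlag paths are bounded and their maxima over dyadic grids increase to their
  supremum, so monotone convergence yields it in continuous time
  (\<open>submartingale_running_max_bound\<close>). The strict inequality after it only compares the
  denominators \<open>1 - p + p \<alpha>\<close> and \<open>1 - p\<close>.

  The constant martingale gives equality in the maximal inequality, with \<open>\<alpha> = 1\<close>. For the last claim, a normally
  distributed increment of the Brownian motion yields a uniform variable \<open>U\<close>. The
  process that follows \<open>x0 / (1 - a t)\<close> and is set to zero from time \<open>U / a\<close> on is a martingale: survival
  up to time \<open>t\<close> has probability \<open>1 - a t\<close>. Its maximum is \<open>x0 / (1 - min U (a T))\<close>, whose \<open>p\<close>-th moment
  tends to \<open>x0^p / (1 - p)\<close> as \<open>a T\<close> tends to 1.
\<close>

section \<open>Tangents of a concave power along a path\<close>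

text \<open>
  Concavity, in the form of Young's inequality \<open>r^p a^(1-p) \<le> p r + (1 - p) a\<close>. It needs \<open>r > 0\<close>; at \<open>r = 0\<close> the
  right-hand side is \<open>(1 - p) a^p\<close>.
\<close>

lemma powr_le_tangent:
  fixes r a p :: real
  assumes "0 \<le> r" "0 < a" "0 < p" "p < 1"
  shows "r powr p \<le> a powr p + p * a powr (p - 1) * (r - a)"
proof -
  have a: "a powr p = a * a powr (p - 1)"
    using assms by (simp add: powr_mult_base)
  show ?thesis
  proof (cases "r = 0")
    case True
    then show ?thesis
      using assms by (simp add: a mult_right_mono algebra_simps)
  next
    case False
    then have "r powr p * a powr (1 - p) \<le> p * r + (1 - p) * a"
      using assms Youngs_inequality_0[of p "1 - p" r a] by simp
    then have "r powr p * a powr (1 - p) * a powr (p - 1) \<le> (p * r + (1 - p) * a) * a powr (p - 1)"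
      by (intro mult_right_mono) auto
    moreover have "a powr (1 - p) * a powr (p - 1) = 1"
      using assms by (simp flip: powr_add)
    ultimately show ?thesis
      by (simp add: a mult.assoc algebra_simps)
  qed
qed

text \<open>
  For \<open>y > 0\<close> this is \<open>y^p + p y^(p-1) (x - y)\<close>, the tangent of \<open>x^p\<close> at \<open>y\<close>, evaluated at \<open>x\<close>.
\<close>

definition powr_tangent :: "real \<Rightarrow> real \<Rightarrow> real \<Rightarrow> real" where
  "powr_tangent p x y = (1 - p) * y powr p + p * x * y powr (p - 1)"

lemma powr_tangent_self: "0 < y \<Longrightarrow> powr_tangent p y y = y powr p"
  by (simp add: powr_tangent_def mult.assoc powr_mult_base algebra_simps)

text \<open>
  If the maximum does not move, the tangent is the same affine function of \<open>x\<close>, and equality holds.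
  If it moves to \<open>x'\<close>, the left-hand side is \<open>x'^p\<close>, which lies below the old tangent.
\<close>

lemma powr_tangent_max_step:
  assumes "0 < y" "0 \<le> x'" "0 < p" "p < 1"
  shows "powr_tangent p x' (max y x') \<le> powr_tangent p x y + p * y powr (p - 1) * (x' - x)"
proof (cases "x' \<le> y")
  case True
  then show ?thesis by (simp add: powr_tangent_def max_absorb1 algebra_simps)
next
  case False
  have y: "y powr p = y * y powr (p - 1)" using assms by (simp add: powr_mult_base)
  have "powr_tangent p x' (max y x') = x' powr p"
    using False assms by (simp add: max_absorb2 powr_tangent_self)
  also have "\<dots> \<le> y powr p + p * y powr (p - 1) * (x' - y)"
    using assms by (intro powr_le_tangent) auto
  also have "\<dots> = powr_tangent p x y + p * y powr (p - 1) * (x' - x)"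
    by (simp add: powr_tangent_def y algebra_simps)
  finally show ?thesis .
qed

text \<open>
  This is the tangent of \<open>r^p\<close> at \<open>b\<close>, used for the ratio \<open>r = x / y\<close>: it trades the mixed
  term \<open>x y^(p-1)\<close>, whose expectation is not accessible, for \<open>x^p\<close> and \<open>y^p\<close>. The parameter \<open>b\<close> is chosen
  only after taking expectations, which replaces Hoelder's inequality.
\<close>

lemma powr_tangent_ge_mix:
  assumes "0 < y" "0 \<le> x" "0 < b" "0 < p" "p < 1"
  shows "(1 - p) * (1 - b) * y powr p + b powr (1 - p) * x powr p \<le> powr_tangent p x y"
proof -
  have y: "y powr p = y * y powr (p - 1)" using assms by (simp add: powr_mult_base)
  have b: "b powr (1 - p) * b powr (p - 1) = 1"
    using assms by (simp flip: powr_add)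
  have b': "b powr p = b * b powr (p - 1)"
    using assms by (simp add: powr_mult_base)
  have "x powr p \<le> (b * y) powr p + p * (b * y) powr (p - 1) * (x - b * y)"
    using assms by (intro powr_le_tangent) auto
  also have "\<dots> = b powr (p - 1) * (b * y powr p + p * y powr (p - 1) * (x - b * y))"
    using assms by (simp add: powr_mult b' algebra_simps)
  finally have "b powr (1 - p) * x powr p \<le>
      b powr (1 - p) * (b powr (p - 1) * (b * y powr p + p * y powr (p - 1) * (x - b * y)))"
    by (intro mult_left_mono) auto
  also have "\<dots> = b * y powr p + p * y powr (p - 1) * (x - b * y)"
    unfolding mult.assoc[symmetric] b by simp
  finally show ?thesis
    by (simp add: powr_tangent_def y algebra_simps)
qed

text \<open>
  A pathwise form of Doob's inequality: the sum on the right is a discrete stochastic integral of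
  the tangent slopes.
\<close>

lemma powr_tangent_path_le:
  fixes x :: "nat \<Rightarrow> real"
  assumes x0: "0 < x 0" and "\<And>i. 0 \<le> x i" and p: "0 < p" "p < 1"
  defines "y \<equiv> \<lambda>n. Max (x ` {..n})"
  shows "powr_tangent p (x n) (y n)
           \<le> x 0 powr p + (\<Sum>i<n. p * y i powr (p - 1) * (x (Suc i) - x i))"
proof (induction n)
  case 0
  then show ?case by (simp add: y_def powr_tangent_self x0)
next
  case (Suc n)
  have "x 0 \<le> y n" unfolding y_def by (intro Max_ge) auto
  then have "0 < y n" using x0 by simp
  moreover have "y (Suc n) = max (y n) (x (Suc n))"
    unfolding y_def atMost_Suc image_insert by (subst Max_insert) (auto simp: max.commute)
  ultimately show ?case
    using powr_tangent_max_step[of "y n" "x (Suc n)" p "x n"] Suc assms by simp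
qed

section \<open>The equation that determines the constant\<close>

text \<open>
  The product of \<open>a^(-p)\<close> and \<open>1 - p + p a\<close>, multiplied out.
\<close>

definition moment_profile :: "real \<Rightarrow> real \<Rightarrow> real" where
  "moment_profile p a = (1 - p) * a powr (- p) + p * a powr (1 - p)"

lemma moment_profile_one [simp]: "moment_profile p 1 = 1"
  by (simp add: moment_profile_def)

lemma continuous_on_moment_profile: "continuous_on {0<..} (moment_profile p)"
  unfolding moment_profile_def by (intro continuous_intros) auto

lemma moment_profile_strict_antimono:
  assumes "0 < a" "a < b" "b \<le> 1" "0 < p" "p < 1"
  shows "moment_profile p b < moment_profile p a"
proof (rule DERIV_neg_imp_decreasing_open[OF \<open>a < b\<close>])
  fix x assume x: "a < x" "x < b"
  then have x': "0 < x" "x < 1" using assms by auto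
  have "DERIV (moment_profile p) x :> (1 - p) * (- p * x powr (- p - 1)) + p * ((1 - p) * x powr (1 - p - 1))"
    unfolding moment_profile_def
    by (intro DERIV_add DERIV_cmult has_real_derivative_powr x')
  moreover have "x powr (- p - 1) > x powr (- p)"
    using x' assms by (simp add: powr_less_mono')
  then have "(1 - p) * (- p * x powr (- p - 1)) + p * ((1 - p) * x powr (1 - p - 1)) < 0"
    using assms by simp
  ultimately show "\<exists>y. DERIV (moment_profile p) x :> y \<and> y < 0" by blast
next
  show "continuous_on {a..b} (moment_profile p)"
    using assms by (intro continuous_on_subset[OF continuous_on_moment_profile]) auto
qed

lemma moment_equation_iff:
  assumes "0 < a" "0 < p" "p < 1"
  shows "m * a powr (- p) = C / (1 - p + p * a) \<longleftrightarrow> m * moment_profile p a = C"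
proof -
  have "a powr (1 - p) = a * a powr (- p)" using assms by (simp add: powr_mult_base)
  then have "moment_profile p a = a powr (- p) * (1 - p + p * a)"
    by (simp add: moment_profile_def algebra_simps)
  then have eq: "m * moment_profile p a = m * a powr (- p) * (1 - p + p * a)" by simp
  have "1 - p + p * a > 0" using assms by (simp add: add_pos_pos)
  then show ?thesis unfolding eq by (simp add: eq_divide_eq)
qed

text \<open>
  The value at \<open>1\<close> is \<open>m \<le> C\<close>, and the profile is unbounded near \<open>0\<close>; strict monotonicity gives
  uniqueness.
\<close>

lemma moment_profile_solution_unique:
  assumes "0 < m" "m \<le> C" "0 < p" "p < 1"
  shows "\<exists>!a. a \<in> {0<..1} \<and> m * moment_profile p a = C"
proof -
  \<comment> \<open>At \<open>a0\<close> the first term of the profile alone already contributes \<open>C\<close>.\<close>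
  define a0 where "a0 = (m * (1 - p) / C) powr (1 / p)"
  have "m * (1 - p) \<le> m * 1" using assms by (intro mult_left_mono) auto
  then have "m * (1 - p) \<le> C" using assms by linarith
  then have q: "0 < m * (1 - p) / C" "m * (1 - p) / C \<le> 1"
    using assms by simp_all
  then have a0: "0 < a0" "a0 \<le> 1"
    unfolding a0_def using assms by (auto intro: powr_le1)
  have "a0 powr (- p) = C / (m * (1 - p))"
    unfolding a0_def powr_powr using assms q(1) by (simp add: powr_minus_divide)
  then have "m * ((1 - p) * a0 powr (- p)) = C"
    using assms by simp
  then have "C \<le> m * moment_profile p a0"
    using assms by (simp add: moment_profile_def distrib_left)
  then have ex: "\<exists>a\<ge>a0. a \<le> 1 \<and> m * moment_profile p a = C"
    using a0 assms
    by (intro IVT2' continuous_intros continuous_on_subset[OF continuous_on_moment_profile]) auto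
  have inj: "a = b" if "a \<in> {0<..1}" "b \<in> {0<..1}" "m * moment_profile p a = C"
      "m * moment_profile p b = C" for a b
  proof -
    have "moment_profile p a = moment_profile p b" using that assms by auto
    then show ?thesis
      using that assms moment_profile_strict_antimono[of a b p]
        moment_profile_strict_antimono[of b a p] by (cases a b rule: linorder_cases) auto
  qed
  from ex obtain a where "a0 \<le> a" "a \<le> 1" "m * moment_profile p a = C" by blast
  then show ?thesis using a0 inj by (intro ex1I[of _ a]) auto
qed

section \<open>Increments of a submartingale weighted by its past\<close>

lemma sets_natural_filtration:
  "sets (natural_filtration M X s) =
     sigma_sets (space M) (\<Union>r\<in>{0..s}. {X r -` A \<inter> space M | A. A \<in> sets borel})"
  unfolding natural_filtration_def by (rule sets_measure_of) auto

lemma space_natural_filtration [simp]: "space (natural_filtration M X s) = space M"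
  by (simp add: natural_filtration_def space_measure_of_conv)

lemma natural_filtration_measurable:
  assumes "r \<in> {0..s}"
  shows "X r \<in> borel_measurable (natural_filtration M X s)"
proof (rule measurableI)
  fix A :: "real set" assume "A \<in> sets borel"
  then have "X r -` A \<inter> space M \<in> (\<Union>r\<in>{0..s}. {X r -` A \<inter> space M | A. A \<in> sets borel})"
    using assms by blast
  then show "X r -` A \<inter> space (natural_filtration M X s) \<in> sets (natural_filtration M X s)"
    unfolding sets_natural_filtration space_natural_filtration by (rule sigma_sets.Basic)
qed simp

lemma natural_filtration_subalgebra:
  assumes "\<And>r. r \<in> {0..s} \<Longrightarrow> X r \<in> borel_measurable M"
  shows "subalgebra M (natural_filtration M X s)"
proof -
  have "(\<Union>r\<in>{0..s}. {X r -` A \<inter> space M | A. A \<in> sets borel}) \<subseteq> sets M"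
    using assms by (auto intro: measurable_sets)
  then show ?thesis
    unfolding subalgebra_def sets_natural_filtration by (simp add: sets.sigma_sets_subset)
qed

lemma (in prob_space) natural_filtration_sigma_finite:
  assumes "\<And>r. r \<in> {0..s} \<Longrightarrow> X r \<in> borel_measurable M"
  shows "sigma_finite_subalgebra M (natural_filtration M X s)"
proof -
  interpret finite_measure_subalgebra M "natural_filtration M X s"
    using natural_filtration_subalgebra[OF assms] by unfold_locales
  show ?thesis by unfold_locales
qed

text \<open>
  By conditioning, \<open>X t\<close> may be replaced by its conditional expectation given the past, because \<open>Z\<close> is
  measurable with respect to the past; the submartingale property and \<open>Z \<ge> 0\<close> finish.
\<close>

lemma (in prob_space) submartingale_weighted_increment:
  assumes X: "submartingale_on M T X" and st: "0 \<le> s" "s \<le> t" "t \<le> T"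
    and Z: "Z \<in> borel_measurable (natural_filtration M X s)"
    and Z_bound: "\<And>\<omega>. \<omega> \<in> space M \<Longrightarrow> 0 \<le> Z \<omega> \<and> Z \<omega> \<le> C"
  shows "integrable M (\<lambda>\<omega>. Z \<omega> * (X t \<omega> - X s \<omega>))"
    and "0 \<le> (\<integral>\<omega>. Z \<omega> * (X t \<omega> - X s \<omega>) \<partial>M)"
proof -
  let ?F = "natural_filtration M X s"
  have int: "integrable M (X r)" if "r \<in> {0..T}" for r
    using X that by (auto simp: submartingale_on_def)
  interpret sigma_finite_subalgebra M ?F
    using st by (intro natural_filtration_sigma_finite borel_measurable_integrable int) auto
  have ZM: "Z \<in> borel_measurable M" by (rule measurable_from_subalg[OF subalg Z])
  have Zint: "integrable M (\<lambda>\<omega>. Z \<omega> * X r \<omega>)" if "r \<in> {0..T}" for r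
    using ZM int[OF that] Z_bound
    by (intro Bochner_Integration.integrable_bound[of M "\<lambda>\<omega>. C * X r \<omega>" "\<lambda>\<omega>. Z \<omega> * X r \<omega>"])
       (force simp: abs_mult intro!: AE_I2 mult_right_mono)+
  have ints: "integrable M (\<lambda>\<omega>. Z \<omega> * X t \<omega>)" "integrable M (\<lambda>\<omega>. Z \<omega> * X s \<omega>)"
    using st by (auto intro!: Zint)
  then show "integrable M (\<lambda>\<omega>. Z \<omega> * (X t \<omega> - X s \<omega>))"
    by (simp add: right_diff_distrib)
  note ce = real_cond_exp_intg[OF ints(1) Z borel_measurable_integrable[OF int]]
  have "(\<integral>\<omega>. Z \<omega> * X s \<omega> \<partial>M) \<le> (\<integral>\<omega>. Z \<omega> * real_cond_exp M ?F (X t) \<omega> \<partial>M)"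
  proof (rule integral_mono_AE[OF ints(2) ce(1)])
    have "AE \<omega> in M. X s \<omega> \<le> real_cond_exp M ?F (X t) \<omega>"
      using X st by (auto simp: submartingale_on_def)
    then show "AE \<omega> in M. Z \<omega> * X s \<omega> \<le> Z \<omega> * real_cond_exp M ?F (X t) \<omega>"
      using AE_space by eventually_elim (use Z_bound in \<open>auto intro: mult_left_mono\<close>)
  qed (use st in auto)
  also have "\<dots> = (\<integral>\<omega>. Z \<omega> * X t \<omega> \<partial>M)" using st by (intro ce(2)) auto
  finally show "0 \<le> (\<integral>\<omega>. Z \<omega> * (X t \<omega> - X s \<omega>) \<partial>M)"
    using ints by (simp add: right_diff_distrib)
qed

section \<open>The maximal inequality along a finite grid\<close>

lemma Max_le_sum_nonneg:
  fixes f :: "'b \<Rightarrow> real"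
  assumes "finite I" "I \<noteq> {}" "\<And>i. i \<in> I \<Longrightarrow> 0 \<le> f i"
  shows "Max (f ` I) \<le> sum f I"
proof -
  have "Max (f ` I) \<in> f ` I" using assms by (intro Max_in) auto
  then show ?thesis using assms member_le_sum[of _ I f] by auto
qed

text \<open>
  The tangent at \<open>1\<close> dominates the power by \<open>1 + f\<close>.
\<close>

lemma integrable_powr_of_integrable:
  fixes f :: "'a \<Rightarrow> real"
  assumes "prob_space M" "integrable M f" "\<And>\<omega>. \<omega> \<in> space M \<Longrightarrow> 0 \<le> f \<omega>" "0 < p" "p < 1"
  shows "integrable M (\<lambda>\<omega>. f \<omega> powr p)"
proof -
  interpret prob_space M by fact
  have "f \<omega> powr p \<le> 1 + f \<omega>" if "\<omega> \<in> space M" for \<omega>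
  proof -
    have "f \<omega> powr p \<le> 1 powr p + p * 1 powr (p - 1) * (f \<omega> - 1)"
      using assms that by (intro powr_le_tangent) auto
    moreover have "p * f \<omega> \<le> 1 * f \<omega>"
      using assms that by (intro mult_right_mono) auto
    ultimately show ?thesis using assms by (simp add: algebra_simps)
  qed
  then show ?thesis
    using assms
    by (intro Bochner_Integration.integrable_bound[of M "\<lambda>\<omega>. 1 + f \<omega>" "\<lambda>\<omega>. f \<omega> powr p"]) 
       (auto intro!: AE_I2 intro: order.trans)
qed

text \<open>
  The expectation of the pathwise inequality. The slopes \<open>y\<^sub>i^(p-1)\<close> never exceed
  the initial one, since the maximum is at least \<open>x0\<close> and \<open>p < 1\<close>. The deficit is a
  non-negative weight known at time \<open>t i\<close>, so dropping its contribution only increases the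
  right-hand side, and what remains telescopes.
\<close>

lemma (in prob_space) integral_powr_tangent_max_le:
  assumes X: "nonneg_cadlag_from M T x0 X" "submartingale_on M T X"
    and pos: "0 < x0" "0 < p" "p < 1"
    and t0: "t 0 = 0" and t_mono: "\<And>i. t i \<le> t (Suc i)" and t_le: "\<And>i. t i \<le> T"
  defines "Y \<equiv> \<lambda>n \<omega>. Max ((\<lambda>i. X (t i) \<omega>) ` {..n})"
  shows "integrable M (\<lambda>\<omega>. Y n \<omega> powr p)"
    and "integrable M (\<lambda>\<omega>. powr_tangent p (X (t n) \<omega>) (Y n \<omega>))"
    and "(\<integral>\<omega>. powr_tangent p (X (t n) \<omega>) (Y n \<omega>) \<partial>M)
           \<le> x0 powr p + p * x0 powr (p - 1) * ((\<integral>\<omega>. X (t n) \<omega> \<partial>M) - x0)"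
proof -
  have t_nonneg: "0 \<le> t i" for i
    using t0 lift_Suc_mono_le[of t 0 i, OF t_mono] by simp
  have t_le_t: "t i \<le> t j" if "i \<le> j" for i j
    using lift_Suc_mono_le[of t i j, OF t_mono that] .
  have t_in: "t i \<in> {0..T}" for i using t_nonneg t_le by auto
  have int: "integrable M (X (t i))" for i
    using X(2) t_in by (auto simp: submartingale_on_def)
  have path: "X (t 0) \<omega> = x0" "0 \<le> X (t i) \<omega>" if "\<omega> \<in> space M" for i \<omega>
    using X(1) that t_in t0 by (auto simp: nonneg_cadlag_from_def)
  have Y_ge: "x0 \<le> Y i \<omega>" "X (t i) \<omega> \<le> Y i \<omega>" if "\<omega> \<in> space M" for i \<omega>
  proof -
    have "X (t 0) \<omega> \<le> Y i \<omega>" unfolding Y_def by (intro Max_ge) auto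
    then show "x0 \<le> Y i \<omega>" using path that by simp
    show "X (t i) \<omega> \<le> Y i \<omega>" unfolding Y_def by (intro Max_ge) auto
  qed
  have Y_weight: "0 \<le> Y i \<omega> powr (p - 1)" "Y i \<omega> powr (p - 1) \<le> x0 powr (p - 1)"
    if "\<omega> \<in> space M" for i \<omega>
    using Y_ge[OF that] pos by (auto intro: powr_mono2')
  have Y_filt: "Y i \<in> borel_measurable (natural_filtration M X (t i))" for i
    unfolding Y_def using t_nonneg t_le_t
    by (intro borel_measurable_Max natural_filtration_measurable) auto
  have YM[measurable]: "Y i \<in> borel_measurable M" for i
    unfolding Y_def using int by (intro borel_measurable_Max) auto
  have "integrable M (Y i)" for i
  proof (rule Bochner_Integration.integrable_bound[of M "\<lambda>\<omega>. \<Sum>j\<le>i. X (t j) \<omega>"])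
    show "AE \<omega> in M. norm (Y i \<omega>) \<le> norm (\<Sum>j\<le>i. X (t j) \<omega>)"
    proof (intro AE_I2)
      fix \<omega> assume \<omega>: "\<omega> \<in> space M"
      have "Y i \<omega> \<le> (\<Sum>j\<le>i. X (t j) \<omega>)"
        unfolding Y_def using path \<omega> by (intro Max_le_sum_nonneg) auto
      then show "norm (Y i \<omega>) \<le> norm (\<Sum>j\<le>i. X (t j) \<omega>)"
        using Y_ge(1)[OF \<omega>, of i] pos by auto
    qed
  qed (use int in auto)
  then show Yint: "integrable M (\<lambda>\<omega>. Y n \<omega> powr p)"
    using Y_ge pos by (intro integrable_powr_of_integrable) (auto intro: prob_space_axioms order.trans[of 0 x0])
  have "integrable M (\<lambda>\<omega>. Y n \<omega> powr (p - 1) * X (t n) \<omega>)"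
  proof (rule Bochner_Integration.integrable_bound[of M "\<lambda>\<omega>. x0 powr (p - 1) * X (t n) \<omega>"])
    show "AE \<omega> in M. norm (Y n \<omega> powr (p - 1) * X (t n) \<omega>) \<le> norm (x0 powr (p - 1) * X (t n) \<omega>)"
      using Y_weight path by (intro AE_I2) (auto simp: abs_mult intro!: mult_right_mono)
  qed (use int in auto)
  then have "integrable M (\<lambda>\<omega>. (1 - p) * Y n \<omega> powr p + p * (Y n \<omega> powr (p - 1) * X (t n) \<omega>))"
    using Yint by auto
  then show pint: "integrable M (\<lambda>\<omega>. powr_tangent p (X (t n) \<omega>) (Y n \<omega>))"
    by (simp add: powr_tangent_def mult_ac)
  \<comment> \<open>\<open>Z\<close> is the deficit of the slope, and \<open>d\<close> the increment that it multiplies.\<close>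
  define Z where "Z i \<omega> = x0 powr (p - 1) - Y i \<omega> powr (p - 1)" for i \<omega>
  define d where "d i \<omega> = X (t (Suc i)) \<omega> - X (t i) \<omega>" for i \<omega>
  have dint: "integrable M (d i)" for i
    unfolding d_def using int by auto
  have Zd: "integrable M (\<lambda>\<omega>. Z i \<omega> * d i \<omega>)" "0 \<le> (\<integral>\<omega>. Z i \<omega> * d i \<omega> \<partial>M)" for i
  proof -
    have "Z i \<in> borel_measurable (natural_filtration M X (t i))"
      unfolding Z_def using Y_filt by measurable
    moreover have "0 \<le> Z i \<omega> \<and> Z i \<omega> \<le> x0 powr (p - 1)" if "\<omega> \<in> space M" for \<omega>
      using Y_weight[OF that] by (simp add: Z_def)
    ultimately show "integrable M (\<lambda>\<omega>. Z i \<omega> * d i \<omega>)" "0 \<le> (\<integral>\<omega>. Z i \<omega> * d i \<omega> \<partial>M)"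
      unfolding d_def
      using submartingale_weighted_increment[OF X(2) t_nonneg t_mono t_le, where Z = "Z i"] by blast+
  qed
  have "(\<integral>\<omega>. powr_tangent p (X (t n) \<omega>) (Y n \<omega>) \<partial>M)
      \<le> (\<integral>\<omega>. x0 powr p + (\<Sum>i<n. p * (x0 powr (p - 1) * d i \<omega> - Z i \<omega> * d i \<omega>)) \<partial>M)"
  proof (rule integral_mono_AE[OF pint])
    show "AE \<omega> in M. powr_tangent p (X (t n) \<omega>) (Y n \<omega>)
        \<le> x0 powr p + (\<Sum>i<n. p * (x0 powr (p - 1) * d i \<omega> - Z i \<omega> * d i \<omega>))"
    proof (intro AE_I2)
      fix \<omega> assume \<omega>: "\<omega> \<in> space M"
      show "powr_tangent p (X (t n) \<omega>) (Y n \<omega>)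
        \<le> x0 powr p + (\<Sum>i<n. p * (x0 powr (p - 1) * d i \<omega> - Z i \<omega> * d i \<omega>))"
        using powr_tangent_path_le[of "\<lambda>i. X (t i) \<omega>" p n] path[OF \<omega>] pos
        by (simp add: Y_def Z_def d_def algebra_simps)
    qed
  qed (use dint Zd in auto)
  also have "\<dots> = x0 powr p + (\<Sum>i<n. p * (x0 powr (p - 1) * (\<integral>\<omega>. d i \<omega> \<partial>M) - (\<integral>\<omega>. Z i \<omega> * d i \<omega> \<partial>M)))"
    using dint Zd by (simp add: prob_space)
  also have "\<dots> \<le> x0 powr p + (\<Sum>i<n. p * (x0 powr (p - 1) * (\<integral>\<omega>. d i \<omega> \<partial>M)))"
    using Zd(2) pos by (intro add_left_mono sum_mono mult_left_mono) auto
  also have "(\<Sum>i<n. p * (x0 powr (p - 1) * (\<integral>\<omega>. d i \<omega> \<partial>M)))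
      = p * x0 powr (p - 1) * (\<Sum>i<n. (\<integral>\<omega>. X (t (Suc i)) \<omega> \<partial>M) - (\<integral>\<omega>. X (t i) \<omega> \<partial>M))"
    using int by (simp add: d_def sum_distrib_left mult.assoc)
  also have "(\<Sum>i<n. (\<integral>\<omega>. X (t (Suc i)) \<omega> \<partial>M) - (\<integral>\<omega>. X (t i) \<omega> \<partial>M))
      = (\<integral>\<omega>. X (t n) \<omega> \<partial>M) - (\<integral>\<omega>. X (t 0) \<omega> \<partial>M)"
    by (rule sum_lessThan_telescope)
  also have "(\<integral>\<omega>. X (t 0) \<omega> \<partial>M) = (\<integral>\<omega>. x0 \<partial>M)"
    using path by (intro Bochner_Integration.integral_cong) auto
  finally show "(\<integral>\<omega>. powr_tangent p (X (t n) \<omega>) (Y n \<omega>) \<partial>M)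
           \<le> x0 powr p + p * x0 powr (p - 1) * ((\<integral>\<omega>. X (t n) \<omega> \<partial>M) - x0)"
    by (simp add: prob_space)
qed

section \<open>Cadlag paths sampled on dyadic grids\<close>

text \<open>
  One-sided limits bound the path near every point; a bisection argument passes from local to global.
\<close>

lemma cadlag_on_bdd_above:
  assumes "cadlag_on T f" "0 \<le> T"
  shows "bdd_above (f ` {0..T})"
proof -
  define P where "P u v \<longleftrightarrow> bdd_above (f ` ({u..v} \<inter> {0..T}))" for u v
  have "P 0 T"
  proof (rule Bolzano[where P = P, OF \<open>0 \<le> T\<close>])
    fix a b c assume ab: "P a b" and bc: "P b c"
    have "{a..c} \<inter> {0..T} \<subseteq> {a..b} \<inter> {0..T} \<union> {b..c} \<inter> {0..T}" by auto
    then have "f ` ({a..c} \<inter> {0..T}) \<subseteq> f ` ({a..b} \<inter> {0..T}) \<union> f ` ({b..c} \<inter> {0..T})"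
      unfolding image_Un[symmetric] by (rule image_mono)
    moreover have "bdd_above (f ` ({a..b} \<inter> {0..T}) \<union> f ` ({b..c} \<inter> {0..T}))"
      using ab bc unfolding P_def bdd_above_Un by (rule conjI)
    ultimately show "P a c" unfolding P_def by (rule bdd_above_mono[rotated])
  next
    fix x assume local: "0 \<le> x" "x \<le> T"
    have "\<exists>b<x. \<exists>B. \<forall>y. b < y \<longrightarrow> y < x \<longrightarrow> 0 \<le> y \<longrightarrow> f y \<le> B"
    proof (cases "x = 0")
      case False
      then have "x \<in> {0<..T}" using local by auto
      then obtain l where "(f \<longlongrightarrow> l) (at_left x)"
        using assms unfolding cadlag_on_def by blast
      then have "eventually (\<lambda>y. f y < l + 1) (at_left x)"
        by (rule order_tendstoD) simp
      then show ?thesis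
        unfolding eventually_at_left_field by (meson less_imp_le)
    qed (auto intro!: exI[of _ "-1"])
    then obtain b B where b: "b < x" "\<And>y. b < y \<Longrightarrow> y < x \<Longrightarrow> 0 \<le> y \<Longrightarrow> f y \<le> B" by blast
    have "\<exists>c>x. \<exists>C. \<forall>y. x < y \<longrightarrow> y < c \<longrightarrow> y \<le> T \<longrightarrow> f y \<le> C"
    proof (cases "x = T")
      case False
      then have "(f \<longlongrightarrow> f x) (at_right x)"
        using assms local by (auto simp: cadlag_on_def)
      then have "eventually (\<lambda>y. f y < f x + 1) (at_right x)"
        by (rule order_tendstoD) simp
      then show ?thesis
        unfolding eventually_at_right_field by (meson less_imp_le)
    qed (auto intro!: exI[of _ "T + 1"])
    then obtain c C where c: "x < c" "\<And>y. x < y \<Longrightarrow> y < c \<Longrightarrow> y \<le> T \<Longrightarrow> f y \<le> C" by blast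
    have bound: "f y \<le> max (f x) (max B C)" if "b < y" "y < c" "y \<in> {0..T}" for y
      using b(2)[of y] c(2)[of y] that by (cases y x rule: linorder_cases) (auto simp: le_max_iff_disj)
    show "\<exists>d>0. \<forall>u v. u \<le> x \<and> x \<le> v \<and> v - u < d \<longrightarrow> P u v"
    proof (intro exI[of _ "min (x - b) (c - x)"] conjI allI impI)
      fix u v assume "u \<le> x \<and> x \<le> v \<and> v - u < min (x - b) (c - x)"
      then show "P u v"
        unfolding P_def by (intro bdd_aboveI2[of _ _ "max (f x) (max B C)"] bound) auto
    qed (use b c in auto)
  qed
  then show ?thesis by (simp add: P_def)
qed

text \<open>
  The grid is stopped at \<open>T\<close> so that every index gives a time in \<open>{0..T}\<close>; the index \<open>2 ^ k\<close> is the
  first to reach \<open>T\<close>.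
\<close>

definition dyadic_time :: "real \<Rightarrow> nat \<Rightarrow> nat \<Rightarrow> real" where
  "dyadic_time T k i = T * min 1 (real i / 2 ^ k)"

lemma dyadic_time_simps [simp]:
  "dyadic_time T k 0 = 0" "dyadic_time T k (2 ^ k) = T"
  by (simp_all add: dyadic_time_def)

lemma dyadic_time_mono:
  assumes "0 \<le> T" "i \<le> j"
  shows "dyadic_time T k i \<le> dyadic_time T k j"
  unfolding dyadic_time_def using assms
  by (intro mult_left_mono min.mono divide_right_mono) auto

lemma dyadic_time_in: "0 \<le> T \<Longrightarrow> dyadic_time T k i \<in> {0..T}"
  by (auto simp: dyadic_time_def intro: mult_left_le)

lemma dyadic_time_refine: "dyadic_time T (Suc k) (2 * i) = dyadic_time T k i"
  by (simp add: dyadic_time_def)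

lemma dyadic_time_dense:
  assumes "0 \<le> s" "s < u" "u \<le> T"
  obtains k i where "i \<le> 2 ^ k" "s < dyadic_time T k i" "dyadic_time T k i < u"
proof -
  have T: "0 < T" using assms by simp
  obtain k where k: "T / (u - s) < 2 ^ k"
    using real_arch_pow[of 2 "T / (u - s)"] by auto
  define i where "i = nat \<lfloor>s * 2 ^ k / T\<rfloor> + 1"
  have i: "real i = of_int \<lfloor>s * 2 ^ k / T\<rfloor> + 1"
    using assms T by (simp add: i_def)
  have lower: "s < T * (real i / 2 ^ k)"
  proof -
    have "s * 2 ^ k / T < real i" unfolding i by linarith
    then show ?thesis using T by (simp add: field_simps)
  qed
  have upper: "T * (real i / 2 ^ k) < u"
  proof -
    have "real i \<le> s * 2 ^ k / T + 1" unfolding i by linarith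
    then have "T * (real i / 2 ^ k) \<le> s + T / 2 ^ k" using T by (simp add: field_simps)
    also have "T / 2 ^ k < u - s" using k assms by (simp add: field_simps)
    finally show ?thesis by simp
  qed
  then have "T * (real i / 2 ^ k) < T * 1" using assms by simp
  then have "real i / 2 ^ k < 1" using T by (subst (asm) mult_less_cancel_left_pos) auto
  moreover from this have "real i \<le> real (2 ^ k)" by simp
  then have "i \<le> 2 ^ k" by (rule of_nat_le_iff[THEN iffD1])
  ultimately show ?thesis using lower upper by (intro that[of i k]) (auto simp: dyadic_time_def)
qed

lemma dyadic_max_Suc_ge:
  "Max ((\<lambda>i. f (dyadic_time T k i)) ` {..2 ^ k})
     \<le> Max ((\<lambda>i. f (dyadic_time T (Suc k) i)) ` {..2 ^ Suc k})" for f :: "real \<Rightarrow> real"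
proof (rule Max_mono)
  show "(\<lambda>i. f (dyadic_time T k i)) ` {..2 ^ k} \<subseteq> (\<lambda>i. f (dyadic_time T (Suc k) i)) ` {..2 ^ Suc k}"
  proof (rule image_subsetI)
    fix i :: nat assume "i \<in> {..2 ^ k}"
    then show "f (dyadic_time T k i) \<in> (\<lambda>i. f (dyadic_time T (Suc k) i)) ` {..2 ^ Suc k}"
      by (intro image_eqI[of _ _ "2 * i"]) (auto simp: dyadic_time_refine)
  qed
qed auto

text \<open>
  A value close to the supremum is attained at some \<open>s\<close>. Either \<open>s = T\<close>, which belongs to every grid,
  or right-continuity provides a whole interval to the right of \<open>s\<close> on which the path is as large, and
  that interval contains a dyadic point.
\<close>

lemma dyadic_max_tendsto_Sup:
  assumes f: "cadlag_on T f" and T: "0 \<le> T"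
  shows "(\<lambda>k. Max ((\<lambda>i. f (dyadic_time T k i)) ` {..2 ^ k})) \<longlonglongrightarrow> (SUP t\<in>{0..T}. f t)"
proof (rule increasing_LIMSEQ)
  note bdd = cadlag_on_bdd_above[OF f T]
  show "Max ((\<lambda>i. f (dyadic_time T k i)) ` {..2 ^ k}) \<le> (SUP t\<in>{0..T}. f t)" for k
    using dyadic_time_in[OF T] by (intro Max.boundedI) (auto intro!: cSUP_upper bdd)
  fix e :: real assume "0 < e"
  then have "(SUP t\<in>{0..T}. f t) - e < (SUP t\<in>{0..T}. f t)" by simp
  then obtain s where s: "s \<in> {0..T}" "(SUP t\<in>{0..T}. f t) - e < f s"
    using T by (subst (asm) less_cSUP_iff[OF _ bdd]) auto
  have "\<exists>k. \<exists>i\<le>2 ^ k. (SUP t\<in>{0..T}. f t) - e < f (dyadic_time T k i)"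
  proof (cases "s = T")
    case True
    then show ?thesis using s by (intro exI[of _ 0] exI[of _ 1]) (simp add: dyadic_time_def)
  next
    case False
    then have "(f \<longlongrightarrow> f s) (at_right s)" using f s by (auto simp: cadlag_on_def)
    then have "eventually (\<lambda>y. (SUP t\<in>{0..T}. f t) - e < f y) (at_right s)"
      using s(2) by (rule order_tendstoD)
    then obtain u where u: "s < u" "\<And>y. s < y \<Longrightarrow> y < u \<Longrightarrow> (SUP t\<in>{0..T}. f t) - e < f y"
      unfolding eventually_at_right_field by blast
    obtain k i where "i \<le> 2 ^ k" "s < dyadic_time T k i" "dyadic_time T k i < min u T"
      using dyadic_time_dense[of s "min u T" T] u(1) s(1) False
      by (metis atLeastAtMost_iff less_eq_real_def min.cobounded2 min_less_iff_conj)
    then show ?thesis using u(2) by auto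
  qed
  then obtain k i where ki: "i \<le> 2 ^ k" "(SUP t\<in>{0..T}. f t) - e < f (dyadic_time T k i)" by blast
  have "f (dyadic_time T k i) \<le> Max ((\<lambda>i. f (dyadic_time T k i)) ` {..2 ^ k})"
    using ki(1) by (intro Max_ge) auto
  then show "\<exists>k. (SUP t\<in>{0..T}. f t) \<le> Max ((\<lambda>i. f (dyadic_time T k i)) ` {..2 ^ k}) + e"
    using ki(2) by (intro exI[of _ k]) linarith
qed (rule dyadic_max_Suc_ge)

section \<open>The maximal inequality in continuous time\<close>

lemma norm_moment_one:
  assumes "nonneg_cadlag_from M T x0 X" "0 < x0" "0 \<le> T"
  shows "norm_moment M T x0 X 1 = (\<integral>\<omega>. X T \<omega> \<partial>M) / x0"
proof -
  have "(\<integral>\<omega>. X T \<omega> powr 1 \<partial>M) = (\<integral>\<omega>. X T \<omega> \<partial>M)"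
    using assms by (intro Bochner_Integration.integral_cong) (auto simp: nonneg_cadlag_from_def)
  then show ?thesis using assms by (simp add: norm_moment_def powr_minus divide_inverse)
qed

lemma (in prob_space) submartingale_mean_ge:
  assumes "nonneg_cadlag_from M T x0 X" "submartingale_on M T X" "0 \<le> T"
  shows "x0 \<le> (\<integral>\<omega>. X T \<omega> \<partial>M)"
proof -
  have "0 \<le> (\<integral>\<omega>. 1 * (X T \<omega> - X 0 \<omega>) \<partial>M)"
    using assms by (intro submartingale_weighted_increment[where C = 1]) auto
  also have "(\<integral>\<omega>. 1 * (X T \<omega> - X 0 \<omega>) \<partial>M) = (\<integral>\<omega>. X T \<omega> - x0 \<partial>M)"
    using assms by (intro Bochner_Integration.integral_cong) (auto simp: nonneg_cadlag_from_def)
  also have "\<dots> = (\<integral>\<omega>. X T \<omega> \<partial>M) - x0"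
    using assms by (auto simp: submartingale_on_def prob_space)
  finally show ?thesis by simp
qed

text \<open>
  These are the conditions under which the moment equation is solvable. Positivity holds because a
  submartingale started at \<open>x0 > 0\<close> cannot end at zero almost surely; the upper bound is
  the expectation of the tangent at \<open>x0\<close>.
\<close>

lemma (in prob_space) norm_moment_bounds:
  assumes X: "nonneg_cadlag_from M T x0 X" "submartingale_on M T X" 
    and pos: "0 \<le> T" "0 < x0" "0 < p" "p < 1"
  shows "0 < norm_moment M T x0 X p"
    and "norm_moment M T x0 X p \<le> 1 - p + p * norm_moment M T x0 X 1"
proof -
  have nn: "0 \<le> X T \<omega>" if "\<omega> \<in> space M" for \<omega>
    using X that pos by (auto simp: nonneg_cadlag_from_def)
  have int: "integrable M (X T)" using X pos by (auto simp: submartingale_on_def)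
  have intp: "integrable M (\<lambda>\<omega>. X T \<omega> powr p)"
    using int nn pos prob_space_axioms by (intro integrable_powr_of_integrable) auto
  have "(\<integral>\<omega>. X T \<omega> powr p \<partial>M) \<noteq> 0"
  proof
    assume "(\<integral>\<omega>. X T \<omega> powr p \<partial>M) = 0"
    then have "AE \<omega> in M. X T \<omega> powr p = 0"
      using intp by (subst (asm) integral_nonneg_eq_0_iff_AE) auto
    then have "(\<integral>\<omega>. X T \<omega> \<partial>M) = (\<integral>\<omega>. 0 \<partial>M)"
      using int by (intro integral_cong_AE) auto
    then show False using submartingale_mean_ge[OF X] pos by simp
  qed
  moreover have "0 \<le> (\<integral>\<omega>. X T \<omega> powr p \<partial>M)" by (intro integral_nonneg_AE) auto
  ultimately have "0 < (\<integral>\<omega>. X T \<omega> powr p \<partial>M)" by linarith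
  then show "0 < norm_moment M T x0 X p"
    unfolding norm_moment_def using pos by (intro mult_pos_pos) auto
  have "(\<integral>\<omega>. X T \<omega> powr p \<partial>M) \<le> (\<integral>\<omega>. x0 powr p + p * x0 powr (p - 1) * (X T \<omega> - x0) \<partial>M)"
    using int intp nn pos by (intro integral_mono powr_le_tangent) auto
  also have "\<dots> = x0 powr p + p * x0 powr (p - 1) * ((\<integral>\<omega>. X T \<omega> \<partial>M) - x0)"
    using int by (simp add: prob_space)
  also have "\<dots> = x0 powr p * (1 - p + p * norm_moment M T x0 X 1)"
    using pos norm_moment_one[OF X(1)] by (simp add: powr_diff field_simps)
  finally have "x0 powr - p * (\<integral>\<omega>. X T \<omega> powr p \<partial>M)
      \<le> x0 powr - p * (x0 powr p * (1 - p + p * norm_moment M T x0 X 1))"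
    by (intro mult_left_mono) auto
  also have "\<dots> = 1 - p + p * norm_moment M T x0 X 1"
    using pos by (simp add: powr_minus field_simps)
  finally show "norm_moment M T x0 X p \<le> 1 - p + p * norm_moment M T x0 X 1"
    by (simp add: norm_moment_def)
qed

text \<open>
  For \<open>\<alpha> < 1\<close> the choice \<open>b = \<alpha>\<close> in \<open>powr_tangent_ge_mix\<close> would suffice. At \<open>\<alpha> = 1\<close> it degenerates,
  because the factor \<open>1 - b\<close> vanishes; approaching \<open>\<alpha>\<close> from below covers both cases.
\<close>

lemma (in prob_space) integral_powr_grid_max_le:
  assumes X: "nonneg_cadlag_from M T x0 X" "submartingale_on M T X"
    and pos: "0 < x0" "0 < p" "p < 1"
    and t: "t 0 = 0" "\<And>i. t i \<le> t (Suc i)" "\<And>i. t i \<le> T" "t n = T"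
    and \<alpha>: "0 < \<alpha>" "\<alpha> \<le> 1"
      "norm_moment M T x0 X p * moment_profile p \<alpha> = 1 - p + p * norm_moment M T x0 X 1"
  shows "(\<integral>\<omega>. Max ((\<lambda>i. X (t i) \<omega>) ` {..n}) powr p \<partial>M)
           \<le> x0 powr p * norm_moment M T x0 X p * \<alpha> powr (- p)"
proof -
  let ?Y = "\<lambda>\<omega>. Max ((\<lambda>i. X (t i) \<omega>) ` {..n})"
  let ?m = "norm_moment M T x0 X"
  have T: "0 \<le> T" using t(1) t(3)[of 0] by simp
  note grid = integral_powr_tangent_max_le[where t = t and n = n, OF X pos t(1-3), unfolded t(4)]
  have nn: "0 \<le> X T \<omega>" if "\<omega> \<in> space M" for \<omega>
    using X that T by (auto simp: nonneg_cadlag_from_def)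
  have int: "integrable M (X T)" using X T by (auto simp: submartingale_on_def)
  have intp: "integrable M (\<lambda>\<omega>. X T \<omega> powr p)"
    using int nn pos prob_space_axioms by (intro integrable_powr_of_integrable) auto
  have Y_pos: "0 < ?Y \<omega>" if "\<omega> \<in> space M" for \<omega>
  proof -
    have "X (t 0) \<omega> \<le> ?Y \<omega>" by (intro Max_ge) auto
    then show ?thesis using X that t pos by (auto simp: nonneg_cadlag_from_def)
  qed
  have XT: "(\<integral>\<omega>. X T \<omega> powr p \<partial>M) = x0 powr p * ?m p"
    using pos by (simp add: norm_moment_def powr_minus field_simps)
  have bound: "(\<integral>\<omega>. ?Y \<omega> powr p \<partial>M) \<le> x0 powr p * ?m p * b powr (- p)" if b: "0 < b" "b < \<alpha>" for b
  proof -
    have "(1 - p) * (1 - b) * (\<integral>\<omega>. ?Y \<omega> powr p \<partial>M) + b powr (1 - p) * (x0 powr p * ?m p)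
        = (\<integral>\<omega>. (1 - p) * (1 - b) * ?Y \<omega> powr p + b powr (1 - p) * X T \<omega> powr p \<partial>M)"
      unfolding XT[symmetric] using grid(1) intp by simp
    also have "\<dots> \<le> (\<integral>\<omega>. powr_tangent p (X T \<omega>) (?Y \<omega>) \<partial>M)"
      using grid(1,2) intp nn Y_pos b pos by (intro integral_mono powr_tangent_ge_mix) auto
    also have "\<dots> \<le> x0 powr p + p * x0 powr (p - 1) * ((\<integral>\<omega>. X T \<omega> \<partial>M) - x0)"
      by (rule grid(3))
    also have "\<dots> = x0 powr p * (1 - p + p * ?m 1)"
      using pos T norm_moment_one[OF X(1)] by (simp add: powr_diff field_simps)
    also have "\<dots> = x0 powr p * (?m p * moment_profile p \<alpha>)"
      by (simp add: \<alpha>)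
    also have "\<dots> \<le> x0 powr p * (?m p * moment_profile p b)"
      using b \<alpha> pos norm_moment_bounds(1)[OF X T pos] moment_profile_strict_antimono[of b \<alpha> p]
      by (intro mult_left_mono) auto
    finally have "(1 - p) * (1 - b) * (\<integral>\<omega>. ?Y \<omega> powr p \<partial>M)
        \<le> x0 powr p * ?m p * (moment_profile p b - b powr (1 - p))"
      by (simp add: algebra_simps)
    also have "moment_profile p b - b powr (1 - p) = (1 - p) * (1 - b) * b powr (- p)"
      using b powr_mult_base[of b "- p"] by (simp add: moment_profile_def algebra_simps)
    finally have "(1 - p) * (1 - b) * (\<integral>\<omega>. ?Y \<omega> powr p \<partial>M)
        \<le> (1 - p) * (1 - b) * (x0 powr p * ?m p * b powr (- p))"
      by (simp add: mult_ac)
    moreover have "0 < (1 - p) * (1 - b)" using b \<alpha> pos by simp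
    ultimately show ?thesis by (rule mult_left_le_imp_le)
  qed
  have "((\<lambda>b. x0 powr p * ?m p * b powr (- p)) \<longlongrightarrow> x0 powr p * ?m p * \<alpha> powr (- p)) (at_left \<alpha>)"
    using \<alpha> by (intro tendsto_intros) auto
  moreover have "eventually (\<lambda>b. (\<integral>\<omega>. ?Y \<omega> powr p \<partial>M) \<le> x0 powr p * ?m p * b powr (- p)) (at_left \<alpha>)"
    unfolding eventually_at_left_field using \<alpha>(1) bound by (intro exI[of _ 0]) auto
  ultimately show ?thesis by (rule tendsto_lowerbound) simp
qed

lemma (in prob_space) submartingale_running_max_bound:
  assumes X: "nonneg_cadlag_from M T x0 X" "submartingale_on M T X"
    and pos: "0 \<le> T" "0 < x0" "0 < p" "p < 1"
    and \<alpha>_in: "\<alpha> \<in> {0<..1}"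
    and \<alpha>_eq: "norm_moment M T x0 X p * \<alpha> powr (- p)
             = (1 - p + p * norm_moment M T x0 X 1) / (1 - p + p * \<alpha>)"
  shows "integrable M (\<lambda>\<omega>. running_max X T \<omega> powr p)"
    and "(\<integral>\<omega>. running_max X T \<omega> powr p \<partial>M)
           \<le> x0 powr p * norm_moment M T x0 X p * \<alpha> powr (- p)"
proof -
  have \<alpha>: "0 < \<alpha>" "\<alpha> \<le> 1"
    "norm_moment M T x0 X p * moment_profile p \<alpha> = 1 - p + p * norm_moment M T x0 X 1"
    using \<alpha>_in \<alpha>_eq pos by (auto simp: moment_equation_iff)
  define Y where "Y k \<omega> = Max ((\<lambda>i. X (dyadic_time T k i) \<omega>) ` {..2 ^ k})" for k \<omega>
  let ?B = "x0 powr p * norm_moment M T x0 X p * \<alpha> powr (- p)"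
  have t: "dyadic_time T k 0 = 0" "dyadic_time T k i \<le> dyadic_time T k (Suc i)"
    "dyadic_time T k i \<le> T" "dyadic_time T k (2 ^ k) = T" for k i
    using pos dyadic_time_mono dyadic_time_in by auto
  have Y_int: "integrable M (\<lambda>\<omega>. Y k \<omega> powr p)" for k
    unfolding Y_def by (intro integral_powr_tangent_max_le[OF X pos(2-4)] t)
  have Y_le: "(\<integral>\<omega>. Y k \<omega> powr p \<partial>M) \<le> ?B" for k
    unfolding Y_def by (intro integral_powr_grid_max_le[OF X pos(2-4)] t \<alpha>)
  have Y_mono: "Y k \<omega> \<le> Y (Suc k) \<omega>" for k \<omega>
    unfolding Y_def by (rule dyadic_max_Suc_ge)
  have Y_pos: "0 \<le> Y k \<omega>" if "\<omega> \<in> space M" for k \<omega>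
  proof -
    have "X (dyadic_time T k 0) \<omega> \<le> Y k \<omega>" unfolding Y_def by (intro Max_ge imageI) auto
    then show ?thesis using X that pos by (auto simp: nonneg_cadlag_from_def)
  qed
  have Yp_mono: "mono (\<lambda>k. Y k \<omega> powr p)" if "\<omega> \<in> space M" for \<omega>
    using Y_mono Y_pos[OF that] pos by (intro mono_iff_le_Suc[THEN iffD2] allI powr_mono2) auto
  have Y_lim: "(\<lambda>k. Y k \<omega>) \<longlonglongrightarrow> running_max X T \<omega>" if "\<omega> \<in> space M" for \<omega>
    unfolding Y_def running_max_def using X that pos
    by (intro dyadic_max_tendsto_Sup) (auto simp: nonneg_cadlag_from_def)
  have Yp_lim: "(\<lambda>k. Y k \<omega> powr p) \<longlonglongrightarrow> running_max X T \<omega> powr p" if "\<omega> \<in> space M" for \<omega>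
    using Y_lim[OF that] Y_pos[OF that] pos by (intro tendsto_powr2) auto
  have "incseq (\<lambda>k. \<integral>\<omega>. Y k \<omega> powr p \<partial>M)"
    using Y_int Yp_mono by (intro incseq_SucI integral_mono monoD[OF Yp_mono]) auto
  then obtain L where L: "(\<lambda>k. \<integral>\<omega>. Y k \<omega> powr p \<partial>M) \<longlonglongrightarrow> L"
    using incseq_convergent Y_le by blast
  have meas: "(\<lambda>\<omega>. running_max X T \<omega> powr p) \<in> borel_measurable M"
    by (rule borel_measurable_LIMSEQ_real[OF Yp_lim borel_measurable_integrable[OF Y_int]])
  show "integrable M (\<lambda>\<omega>. running_max X T \<omega> powr p)"
    by (rule integrable_monotone_convergence[OF Y_int _ _ L meas])
       (intro AE_I2 Yp_mono Yp_lim, assumption)+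
  have "(\<integral>\<omega>. running_max X T \<omega> powr p \<partial>M) = L"
    by (rule integral_monotone_convergence[OF Y_int _ _ L meas])
       (intro AE_I2 Yp_mono Yp_lim, assumption)+
  also have "L \<le> ?B" using LIMSEQ_le_const2[OF L] Y_le by blast
  finally show "(\<integral>\<omega>. running_max X T \<omega> powr p \<partial>M) \<le> ?B" .
qed

section \<open>A martingale with a nearly optimal maximum\<close>

text \<open>
  The probability integral transform: \<open>U\<close> is the distribution function of \<open>Z\<close>, evaluated at \<open>Z\<close>. Positivity
  of the density makes that function strictly increasing, hence \<open>U > 0\<close> at every outcome and not only almost
  surely, as is needed for a path to start at \<open>x0\<close> at every outcome.
\<close>

lemma (in prob_space) uniform_of_positive_density:
  fixes Z :: "'a \<Rightarrow> real"
  assumes Z: "distributed M lborel Z f" and f: "\<And>x. 0 < f x"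
  obtains U where "U \<in> borel_measurable M" "\<And>\<omega>. \<omega> \<in> space M \<Longrightarrow> 0 < U \<omega>"
    "\<And>u. u \<in> {0..1} \<Longrightarrow> prob {\<omega> \<in> space M. U \<omega> \<le> u} = u"
proof -
  have Zm[measurable]: "Z \<in> borel_measurable M"
    using distributed_measurable[OF Z] by simp
  have fm[measurable]: "f \<in> borel_measurable lborel"
    using distributed_borel_measurable[OF Z] .
  define D where "D = distr M borel Z"
  interpret D: real_distribution D
    unfolding D_def by (rule real_distribution_distr) simp
  have D_eq: "emeasure D A = (\<integral>\<^sup>+x. f x * indicator A x \<partial>lborel)" if [measurable]: "A \<in> sets borel" for A
  proof -
    have "emeasure D A = emeasure M (Z -` A \<inter> space M)"
      unfolding D_def by (rule emeasure_distr) auto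
    then show ?thesis using distributed_emeasure[OF Z, of A] that by simp
  qed
  \<comment> \<open>Null sets are those of Lebesgue measure: points give continuity, intervals strict monotonicity.\<close>
  have null_iff: "measure D A = 0 \<longleftrightarrow> emeasure lborel A = 0" if [measurable]: "A \<in> sets borel" for A
  proof -
    have "measure D A = 0 \<longleftrightarrow> emeasure D A = 0"
      by (simp add: D.emeasure_eq_measure)
    also have "\<dots> \<longleftrightarrow> (AE x in lborel. f x * indicator A x = 0)"
      unfolding D_eq[OF that] by (rule nn_integral_0_iff_AE) measurable
    also have "\<dots> \<longleftrightarrow> (AE x in lborel. x \<notin> A)"
      using f by (intro AE_cong) (simp add: indicator_def less_imp_neq[symmetric])
    also have "\<dots> \<longleftrightarrow> emeasure lborel A = 0"
      by (rule AE_iff_measurable) auto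
    finally show ?thesis .
  qed
  have strict: "cdf D x < cdf D y" if "x < y" for x y
  proof -
    have "measure D {x<..y} \<noteq> 0" using that by (subst null_iff) auto
    then have "0 < measure D {x<..y}" by (simp add: zero_less_measure_iff)
    then show ?thesis using D.cdf_diff_eq[OF that] by simp
  qed
  have strict_iff: "cdf D x \<le> cdf D y \<longleftrightarrow> x \<le> y" for x y
    using strict[of y x] D.cdf_nondecreasing[of x y] by linarith
  have cont: "isCont (cdf D) x" for x
    unfolding D.isCont_cdf by (subst null_iff) auto
  have pos: "0 < cdf D x" for x
    using strict[of "x - 1" x] D.cdf_nonneg[of "x - 1"] by simp
  have less1: "cdf D x < 1" for x
    using strict[of x "x + 1"] D.cdf_bounded_prob[of "x + 1"] by simp
  have cdf_prob: "cdf D z = prob {\<omega> \<in> space M. Z \<omega> \<le> z}" for z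
    unfolding cdf_def D_def by (subst measure_distr) (auto intro: arg_cong[where f = prob])
  have [measurable]: "cdf D \<in> borel_measurable borel"
    by (intro borel_measurable_mono monoI D.cdf_nondecreasing)
  show thesis
  proof (rule that)
    show "(\<lambda>\<omega>. cdf D (Z \<omega>)) \<in> borel_measurable M" by measurable
    fix u :: real assume u: "u \<in> {0..1}"
    consider "u = 0" | "u = 1" | "0 < u" "u < 1" using u by force
    then show "prob {\<omega> \<in> space M. cdf D (Z \<omega>) \<le> u} = u"
    proof cases
      case 1
      then have "{\<omega> \<in> space M. cdf D (Z \<omega>) \<le> u} = {}" using pos by (auto simp: not_le)
      then show ?thesis by (simp only: 1 measure_empty)
    next
      case 2
      then show ?thesis using less1 by (simp add: less_imp_le prob_space)
    next
      case 3
      have "eventually (\<lambda>x. cdf D x < u) at_bot" "eventually (\<lambda>x. u < cdf D x) at_top"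
        using 3 D.cdf_lim_at_bot D.cdf_lim_at_top_prob by (auto intro: order_tendstoD)
      then obtain l r where "cdf D l < u" "u < cdf D r"
        unfolding eventually_at_bot_linorder eventually_at_top_linorder by blast
      moreover from this have "l \<le> r" using strict_iff[of l r] by linarith
      ultimately obtain z where z: "cdf D z = u"
        using IVT[of "cdf D" l u r] cont by auto
      then have "{\<omega> \<in> space M. cdf D (Z \<omega>) \<le> u} = {\<omega> \<in> space M. Z \<omega> \<le> z}"
        using strict_iff by auto
      then show ?thesis using z cdf_prob by simp
    qed
  qed (rule pos)
qed

lemma mult_less_one_mono:
  fixes a t T :: real
  assumes "0 < a" "a * T < 1" "t \<le> T"
  shows "a * t < 1"
  using mult_left_mono[of t T a] assms by linarith

text \<open>
  Deterministic growth until the time \<open>U \<omega> / a\<close>, and zero from then on. For uniform \<open>U\<close> the growth rate is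
  exactly what compensates the killing.
\<close>

definition killed_process :: "real \<Rightarrow> real \<Rightarrow> ('a \<Rightarrow> real) \<Rightarrow> real \<Rightarrow> 'a \<Rightarrow> real" where
  "killed_process x0 a U t \<omega> = (if a * t < U \<omega> then x0 / (1 - a * t) else 0)"

text \<open>
  The hypothesis admits the killing time itself, \<open>a * t = U \<omega>\<close>: the left limit there is the value that
  the path loses at that moment, and for \<open>x0 \<ge> 0\<close> it is the supremum of the whole path.
\<close>

lemma killed_process_left_limit:
  assumes "0 < a" "a * t < 1" "a * t \<le> U \<omega>"
  shows "((\<lambda>s. killed_process x0 a U s \<omega>) \<longlongrightarrow> x0 / (1 - a * t)) (at_left t)"
proof (rule Lim_transform_eventually)
  show "((\<lambda>s. x0 / (1 - a * s)) \<longlongrightarrow> x0 / (1 - a * t)) (at_left t)"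
    using assms by (intro tendsto_intros) auto
  have "a * s < U \<omega>" if "s < t" for s
    using mult_strict_left_mono[OF that assms(1)] assms(3) by linarith
  then show "\<forall>\<^sub>F s in at_left t. x0 / (1 - a * s) = killed_process x0 a U s \<omega>"
    unfolding eventually_at_left_field by (intro exI[of _ "t - 1"]) (auto simp: killed_process_def)
qed

lemma cadlag_on_killed_process:
  assumes "0 < a" "a * T < 1"
  shows "cadlag_on T (\<lambda>t. killed_process x0 a U t \<omega>)"
  unfolding cadlag_on_def
proof (intro conjI ballI)
  fix t assume t: "t \<in> {0..<T}"
  then have at: "a * t < 1" using mult_less_one_mono[OF assms, of t] by auto
  show "((\<lambda>t. killed_process x0 a U t \<omega>) \<longlongrightarrow> killed_process x0 a U t \<omega>) (at_right t)"
  proof (cases "a * t < U \<omega>")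
    case True
    have "((\<lambda>s. x0 / (1 - a * s)) \<longlongrightarrow> x0 / (1 - a * t)) (at_right t)"
      using at by (intro tendsto_intros) auto
    moreover have "((\<lambda>s. a * s) \<longlongrightarrow> a * t) (at_right t)" by (intro tendsto_intros)
    then have "eventually (\<lambda>s. a * s < U \<omega>) (at_right t)" using True by (rule order_tendstoD)
    then have "\<forall>\<^sub>F s in at_right t. x0 / (1 - a * s) = killed_process x0 a U s \<omega>"
      by eventually_elim (simp add: killed_process_def)
    ultimately have "((\<lambda>t. killed_process x0 a U t \<omega>) \<longlongrightarrow> x0 / (1 - a * t)) (at_right t)"
      by (rule Lim_transform_eventually)
    then show ?thesis using True by (simp add: killed_process_def)
  next
    case False
    have "U \<omega> \<le> a * s" if "t < s" for s
      using mult_strict_left_mono[OF that assms(1)] False by linarith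
    then have "\<forall>\<^sub>F s in at_right t. 0 = killed_process x0 a U s \<omega>"
      unfolding eventually_at_right_field
      by (intro exI[of _ "t + 1"]) (auto simp: killed_process_def not_less[symmetric])
    then show ?thesis
      using False by (intro Lim_transform_eventually[OF tendsto_const]) (simp add: killed_process_def)
  qed
next
  fix t assume t: "t \<in> {0<..T}"
  then have at: "a * t < 1" using mult_less_one_mono[OF assms, of t] by auto
  show "\<exists>l. ((\<lambda>t. killed_process x0 a U t \<omega>) \<longlongrightarrow> l) (at_left t)"
  proof (cases "a * t \<le> U \<omega>")
    case True
    then show ?thesis using killed_process_left_limit[where U = U and \<omega> = \<omega>, OF assms(1) at] by blast
  next
    case False
    have "((\<lambda>s. a * s) \<longlongrightarrow> a * t) (at_left t)" by (intro tendsto_intros)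
    then have "eventually (\<lambda>s. U \<omega> < a * s) (at_left t)" using False by (intro order_tendstoD) auto
    then have "\<forall>\<^sub>F s in at_left t. 0 = killed_process x0 a U s \<omega>"
      by eventually_elim (simp add: killed_process_def)
    then show ?thesis by (intro exI Lim_transform_eventually[OF tendsto_const])
  qed
qed

lemma nonneg_cadlag_from_killed_process:
  assumes "0 < a" "a * T < 1" "0 \<le> x0" and U: "\<And>\<omega>. \<omega> \<in> space M \<Longrightarrow> 0 < U \<omega>"
  shows "nonneg_cadlag_from M T x0 (killed_process x0 a U)"
proof -
  have "0 \<le> killed_process x0 a U t \<omega>" if "t \<le> T" for t \<omega>
    using mult_less_one_mono[OF assms(1,2) that] assms(3) by (simp add: killed_process_def)
  moreover have "killed_process x0 a U 0 \<omega> = x0" if "\<omega> \<in> space M" for \<omega>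
    using U[OF that] by (simp add: killed_process_def)
  ultimately show ?thesis
    using cadlag_on_killed_process[OF assms(1,2), of x0 U] by (simp add: nonneg_cadlag_from_def)
qed

lemma running_max_killed_process:
  assumes a: "0 < a" "a * T < 1" and "0 \<le> x0" "0 \<le> T" "0 < U \<omega>"
  shows "running_max (killed_process x0 a U) T \<omega> = x0 / (1 - min (U \<omega>) (a * T))"
  unfolding running_max_def
proof (rule antisym)
  let ?X = "\<lambda>t. killed_process x0 a U t \<omega>"
  have upper: "?X t \<le> x0 / (1 - min (U \<omega>) (a * T))" if "t \<in> {0..T}" for t
  proof -
    have less1: "min (U \<omega>) (a * T) < 1" using a by linarith
    show ?thesis
    proof (cases "a * t < U \<omega>")
      case True
      then have "a * t \<le> min (U \<omega>) (a * T)" using a that by simp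
      then have "x0 / (1 - a * t) \<le> x0 / (1 - min (U \<omega>) (a * T))"
        using less1 assms(3) by (intro divide_left_mono mult_pos_pos) linarith+
      then show ?thesis using True by (simp add: killed_process_def)
    next
      case False
      then show ?thesis using less1 assms(3) by (simp add: killed_process_def)
    qed
  qed
  then show "(SUP t\<in>{0..T}. ?X t) \<le> x0 / (1 - min (U \<omega>) (a * T))"
    using assms by (intro cSUP_least) auto
  have X_le: "?X t \<le> (SUP t\<in>{0..T}. ?X t)" if "t \<in> {0..T}" for t
    using upper that by (intro cSUP_upper bdd_aboveI2) auto
  show "x0 / (1 - min (U \<omega>) (a * T)) \<le> (SUP t\<in>{0..T}. ?X t)"
  proof (cases "a * T < U \<omega>")
    case True
    then show ?thesis using X_le[of T] \<open>0 \<le> T\<close> by (simp add: killed_process_def min_absorb2)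
  next
    case False
    define \<tau> where "\<tau> = U \<omega> / a"
    have \<tau>: "a * \<tau> = U \<omega>" "0 < \<tau>" "\<tau> \<le> T" using assms False by (auto simp: \<tau>_def field_simps)
    have "(?X \<longlongrightarrow> x0 / (1 - a * \<tau>)) (at_left \<tau>)"
      using a False \<tau> by (intro killed_process_left_limit) auto
    moreover have "\<forall>\<^sub>F s in at_left \<tau>. ?X s \<le> (SUP t\<in>{0..T}. ?X t)"
      unfolding eventually_at_left_field using \<tau> by (intro exI[of _ 0]) (auto intro!: X_le)
    ultimately have "x0 / (1 - a * \<tau>) \<le> (SUP t\<in>{0..T}. ?X t)"
      by (rule tendsto_upperbound) simp
    then show ?thesis using False \<tau> by (simp add: min_absorb1)
  qed
qed

text \<open>
  Before time \<open>s\<close> all paths that survive \<open>s\<close> coincide, so no event known at time \<open>s\<close> can separate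
  two survivors.
\<close>

lemma killed_process_atom:
  assumes A: "A \<in> sets (natural_filtration M (killed_process x0 a U) s)" and a: "0 < a"
  shows "A \<inter> {\<omega> \<in> space M. a * s < U \<omega>} = {} \<or> {\<omega> \<in> space M. a * s < U \<omega>} \<subseteq> A"
  using A unfolding sets_natural_filtration
proof (induction rule: sigma_sets.induct)
  case (Basic A)
  then obtain r B where r: "0 \<le> r" "r \<le> s" and A: "A = killed_process x0 a U r -` B \<inter> space M"
    by auto
  have "a * r < U \<omega>" if "a * s < U \<omega>" for \<omega>
    using mult_left_mono[OF r(2), of a] a that by linarith
  then show ?case unfolding A by (cases "x0 / (1 - a * r) \<in> B") (auto simp: killed_process_def)
qed blast+

lemma (in prob_space) integral_killed_process:
  assumes t: "0 \<le> a * t" "a * t < 1" and [measurable]: "U \<in> borel_measurable M"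
    and U: "\<And>u. u \<in> {0..1} \<Longrightarrow> prob {\<omega> \<in> space M. U \<omega> \<le> u} = u"
  shows "(\<integral>\<omega>. killed_process x0 a U t \<omega> \<partial>M) = x0"
proof -
  have "{\<omega> \<in> space M. a * t < U \<omega>} = space M - {\<omega> \<in> space M. U \<omega> \<le> a * t}" by auto
  then have P: "prob {\<omega> \<in> space M. a * t < U \<omega>} = 1 - a * t"
    using U[of "a * t"] t by (simp add: prob_compl)
  have "(\<integral>\<omega>. killed_process x0 a U t \<omega> \<partial>M)
      = (\<integral>\<omega>. x0 / (1 - a * t) * indicator {\<omega> \<in> space M. a * t < U \<omega>} \<omega> \<partial>M)"
    by (intro Bochner_Integration.integral_cong) (auto simp: killed_process_def)
  also have "\<dots> = x0 / (1 - a * t) * (1 - a * t)"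
    using P by (simp add: Collect_conj_eq Int_commute)
  finally show ?thesis using t by simp
qed

text \<open>
  The defining identity of the conditional expectation is checked on each past event \<open>A\<close>. From time \<open>s\<close> on the process
  lives on the survivors of \<open>s\<close>, which \<open>A\<close> either contains or misses; so both integrals are \<open>x0\<close>
  or both are \<open>0\<close>.
\<close>

lemma (in prob_space) martingale_on_killed_process:
  assumes a: "0 < a" "a * T < 1" and [measurable]: "U \<in> borel_measurable M"
    and U: "\<And>u. u \<in> {0..1} \<Longrightarrow> prob {\<omega> \<in> space M. U \<omega> \<le> u} = u"
  shows "martingale_on M T (killed_process x0 a U)"
proof -
  let ?X = "killed_process x0 a U"
  have at: "a * t < 1" if "t \<le> T" for t
    using mult_less_one_mono[OF a that] .
  have X_meas[measurable]: "?X t \<in> borel_measurable M" for t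
    unfolding killed_process_def[abs_def] by measurable
  have X_int: "integrable M (?X t)" for t
    by (rule integrable_const_bound[where B = "\<bar>x0 / (1 - a * t)\<bar>"]) (auto simp: killed_process_def)
  have mean: "(\<integral>\<omega>. ?X t \<omega> \<partial>M) = x0" if "0 \<le> t" "t \<le> T" for t
    using that a at U by (intro integral_killed_process) auto
  show ?thesis
    unfolding martingale_on_def
  proof (intro conjI ballI allI impI X_int)
    fix s t assume st: "0 \<le> s" "s \<le> t" "t \<le> T"
    let ?F = "natural_filtration M ?X s"
    interpret sigma_finite_subalgebra M ?F
      by (intro natural_filtration_sigma_finite X_meas)
    show "AE \<omega> in M. real_cond_exp M ?F (?X t) \<omega> = ?X s \<omega>"
    proof (rule real_cond_exp_charact[OF _ X_int X_int])
      show "?X s \<in> borel_measurable ?F" using st by (intro natural_filtration_measurable) auto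
      fix A assume A: "A \<in> sets ?F"
      have vanish: "?X r \<omega> = 0" if "s \<le> r" "\<not> a * s < U \<omega>" for r \<omega>
      proof -
        have "\<not> a * r < U \<omega>" using mult_left_mono[OF that(1), of a] a that(2) by linarith
        then show ?thesis by (simp add: killed_process_def)
      qed
      from killed_process_atom[OF A a(1)]
      show "(LINT \<omega>:A|M. ?X t \<omega>) = (LINT \<omega>:A|M. ?X s \<omega>)"
      proof
        assume "A \<inter> {\<omega> \<in> space M. a * s < U \<omega>} = {}"
        then have "(LINT \<omega>:A|M. ?X r \<omega>) = (\<integral>\<omega>. 0 \<partial>M)" if "s \<le> r" for r
          unfolding set_lebesgue_integral_def using vanish[OF that]
          by (intro Bochner_Integration.integral_cong) (auto simp: indicator_def)
        then show ?thesis using st by simp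
      next
        assume "{\<omega> \<in> space M. a * s < U \<omega>} \<subseteq> A"
        then have "(LINT \<omega>:A|M. ?X r \<omega>) = (\<integral>\<omega>. ?X r \<omega> \<partial>M)" if "s \<le> r" for r
          unfolding set_lebesgue_integral_def using vanish[OF that]
          by (intro Bochner_Integration.integral_cong) (auto simp: indicator_def)
        then show ?thesis using st mean by simp
      qed
    qed
  qed
qed

lemma has_integral_truncated_powr:
  fixes c p :: real
  assumes "0 \<le> c" "c < 1" "p < 1"
  shows "((\<lambda>u. (1 - min u c) powr (- p)) has_integral
      ((1 - (1 - c) powr (1 - p)) / (1 - p) + (1 - c) powr (1 - p))) {0..1}"
proof (rule has_integral_combine)
  have "((\<lambda>u. (1 - u) powr (- p)) has_integral
      (- ((1 - c) powr (1 - p) / (1 - p)) - - ((1 - 0) powr (1 - p) / (1 - p)))) {0..c}"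
  proof (rule fundamental_theorem_of_calculus)
    fix u assume "u \<in> {0..c}"
    then have "((\<lambda>u. (1 - u) powr (1 - p)) has_real_derivative
        (1 - p) * (1 - u) powr (1 - p - of_nat 1) * - 1) (at u)"
      using assms by (intro DERIV_fun_powr) (auto intro!: derivative_eq_intros)
    then have "((\<lambda>u. - ((1 - u) powr (1 - p) / (1 - p))) has_real_derivative
        - ((1 - p) * (1 - u) powr (1 - p - of_nat 1) * - 1 / (1 - p))) (at u)"
      by (intro DERIV_minus DERIV_cdivide)
    also have "- ((1 - p) * (1 - u) powr (1 - p - of_nat 1) * - 1 / (1 - p)) = (1 - u) powr (- p)"
      using assms by simp
    finally have "((\<lambda>u. - ((1 - u) powr (1 - p) / (1 - p))) has_real_derivative (1 - u) powr (- p)) (at u within {0..c})"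
      by (rule has_field_derivative_at_within)
    then show "((\<lambda>u. - ((1 - u) powr (1 - p) / (1 - p))) has_vector_derivative (1 - u) powr (- p)) (at u within {0..c})"
      by (simp add: has_real_derivative_iff_has_vector_derivative)
  qed (use assms in auto)
  then have "((\<lambda>u. (1 - u) powr (- p)) has_integral (1 - (1 - c) powr (1 - p)) / (1 - p)) {0..c}"
    by (simp add: diff_divide_distrib)
  then show "((\<lambda>u. (1 - min u c) powr (- p)) has_integral (1 - (1 - c) powr (1 - p)) / (1 - p)) {0..c}"
    by (rule has_integral_eq[rotated]) auto
  have "((\<lambda>u. (1 - c) powr (- p)) has_integral (1 - c) *\<^sub>R (1 - c) powr (- p)) {c..1}"
    using has_integral_const_real[of "(1 - c) powr (- p)" c 1] assms by simp
  then have "((\<lambda>u. (1 - c) powr (- p)) has_integral (1 - c) powr (1 - p)) {c..1}"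
    using assms powr_mult_base[of "1 - c" "- p"] by simp
  then show "((\<lambda>u. (1 - min u c) powr (- p)) has_integral (1 - c) powr (1 - p)) {c..1}"
    by (rule has_integral_eq[rotated]) auto
qed (use assms in auto)

lemma (in prob_space) integral_running_max_killed_process:
  assumes a: "0 < a" "a * T < 1" and "0 < x0" "0 \<le> T" "0 \<le> p" "p < 1"
    and Um[measurable]: "U \<in> borel_measurable M" and U_pos: "\<And>\<omega>. \<omega> \<in> space M \<Longrightarrow> 0 < U \<omega>"
    and U: "\<And>u. u \<in> {0..1} \<Longrightarrow> prob {\<omega> \<in> space M. U \<omega> \<le> u} = u"
  shows "integrable M (\<lambda>\<omega>. running_max (killed_process x0 a U) T \<omega> powr p)"
    and "(\<integral>\<omega>. running_max (killed_process x0 a U) T \<omega> powr p \<partial>M)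
      = x0 powr p * ((1 - (1 - a * T) powr (1 - p)) / (1 - p) + (1 - a * T) powr (1 - p))"
proof -
  define g where "g u = (1 - min u (a * T)) powr (- p)" for u
  have [measurable]: "g \<in> borel_measurable borel" unfolding g_def by measurable
  have rm: "running_max (killed_process x0 a U) T \<omega> powr p = x0 powr p * g (U \<omega>)"
    if "\<omega> \<in> space M" for \<omega>
  proof -
    have "running_max (killed_process x0 a U) T \<omega> powr p = (x0 / (1 - min (U \<omega>) (a * T))) powr p"
      using assms(1-4) U_pos[OF that] by (subst running_max_killed_process) auto
    also have "\<dots> = x0 powr p / (1 - min (U \<omega>) (a * T)) powr p"
      using assms(1-4) by (intro powr_divide)
    finally show ?thesis by (simp add: g_def powr_minus divide_inverse)
  qed
  have "g u \<le> (1 - a * T) powr (- p)" for u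
    unfolding g_def using assms by (intro powr_mono2') auto
  then have g_int: "integrable M (\<lambda>\<omega>. g (U \<omega>))"
    by (intro integrable_const_bound[where B = "(1 - a * T) powr (- p)"]) (auto simp: g_def)
  then have "integrable M (\<lambda>\<omega>. x0 powr p * g (U \<omega>))" by simp
  then show "integrable M (\<lambda>\<omega>. running_max (killed_process x0 a U) T \<omega> powr p)"
    by (subst Bochner_Integration.integrable_cong[OF refl rm])
  have "distributed M lborel U (\<lambda>x. indicator {0..1} x / measure lborel {0..1::real})"
    unfolding uniform_distributed_iff using U by auto
  then have "(\<integral>\<omega>. g (U \<omega>) \<partial>M) = (\<integral>x. indicator {0..1} x / measure lborel {0..1::real} * g x \<partial>lborel)"
    by (intro distributed_integral[symmetric]) auto
  also have "\<dots> = (LINT x:{0..1}|lborel. g x)"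
    by (simp add: set_lebesgue_integral_def)
  also have "\<dots> = integral {0..1} g"
  proof (rule set_borel_integral_eq_integral)
    show "set_integrable lborel {0..1} g"
      unfolding g_def using assms
      by (intro borel_integrable_atLeastAtMost' continuous_intros) (auto simp: min_def)
  qed
  also have "\<dots> = (1 - (1 - a * T) powr (1 - p)) / (1 - p) + (1 - a * T) powr (1 - p)"
    unfolding g_def using assms by (intro integral_unique has_integral_truncated_powr) auto
  finally have gU: "(\<integral>\<omega>. g (U \<omega>) \<partial>M) = \<dots>" .
  have "(\<integral>\<omega>. running_max (killed_process x0 a U) T \<omega> powr p \<partial>M) = (\<integral>\<omega>. x0 powr p * g (U \<omega>) \<partial>M)"
    using rm by (intro Bochner_Integration.integral_cong) auto
  then show "(\<integral>\<omega>. running_max (killed_process x0 a U) T \<omega> powr p \<partial>M)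
      = x0 powr p * ((1 - (1 - a * T) powr (1 - p)) / (1 - p) + (1 - a * T) powr (1 - p))"
    using gU by simp
qed

lemma (in prob_space) constant_process:
  assumes "0 \<le> x0" "0 \<le> T"
  shows "nonneg_cadlag_from M T x0 (\<lambda>t \<omega>. x0)" "martingale_on M T (\<lambda>t \<omega>. x0)"
    "running_max (\<lambda>t \<omega>. x0) T \<omega> = x0"
proof -
  show "nonneg_cadlag_from M T x0 (\<lambda>t \<omega>. x0)"
    using assms by (auto simp: nonneg_cadlag_from_def cadlag_on_def)
  show "running_max (\<lambda>t \<omega>. x0) T \<omega> = x0" using assms by (simp add: running_max_def)
  show "martingale_on M T (\<lambda>t \<omega>. x0)"
    unfolding martingale_on_def
  proof (intro conjI ballI allI impI)
    fix s t :: real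
    interpret sigma_finite_subalgebra M "natural_filtration M (\<lambda>t \<omega>. x0) s"
      by (intro natural_filtration_sigma_finite) auto
    show "AE \<omega> in M. real_cond_exp M (natural_filtration M (\<lambda>t \<omega>. x0) s) (\<lambda>\<omega>. x0) \<omega> = x0"
      by (rule real_cond_exp_F_meas) auto
  qed simp
qed

lemma (in prob_space) submartingale_moment_equation_unique:
  assumes X: "nonneg_cadlag_from M T x0 X" "submartingale_on M T X"
    and pos: "0 \<le> T" "0 < x0" "0 < p" "p < 1"
  shows "\<exists>!\<alpha>. \<alpha> \<in> {0<..1} \<and>
           norm_moment M T x0 X p * \<alpha> powr (- p)
             = (1 - p + p * norm_moment M T x0 X 1) / (1 - p + p * \<alpha>)"
proof -
  let ?m = "norm_moment M T x0 X"
  let ?C = "1 - p + p * ?m 1"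
  have "(\<alpha> \<in> {0<..1} \<and> ?m p * \<alpha> powr (- p) = ?C / (1 - p + p * \<alpha>))
      \<longleftrightarrow> (\<alpha> \<in> {0<..1} \<and> ?m p * moment_profile p \<alpha> = ?C)" for \<alpha>
    using moment_equation_iff[of \<alpha> p "?m p" ?C] pos by auto
  then show ?thesis
    using moment_profile_solution_unique[OF norm_moment_bounds[OF X pos] pos(3,4)] by simp
qed

text \<open>
  Both sides of the inequality are quotients of the same positive number \<open>S\<close>, positive because the mean of
  \<open>X T\<close> is at least \<open>x0\<close>; the denominator on the left is larger by \<open>p \<alpha>\<close>.
\<close>

lemma (in prob_space) submartingale_moment_bound_value:
  assumes X: "nonneg_cadlag_from M T x0 X" "submartingale_on M T X"
    and pos: "0 \<le> T" "0 < x0" "0 < p" "p < 1"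
    and \<alpha>: "\<alpha> \<in> {0<..1}"
    and eq: "norm_moment M T x0 X p * \<alpha> powr (- p)
             = (1 - p + p * norm_moment M T x0 X 1) / (1 - p + p * \<alpha>)"
  shows "x0 powr p * norm_moment M T x0 X p * \<alpha> powr (- p)
             = x0 powr p / (1 - p + p * \<alpha>)
               + x0 powr (p - 1) * (p / (1 - p + p * \<alpha>)) * ((\<integral>\<omega>. X T \<omega> \<partial>M) - x0)"
    and "x0 powr p / (1 - p + p * \<alpha>)
               + x0 powr (p - 1) * (p / (1 - p + p * \<alpha>)) * ((\<integral>\<omega>. X T \<omega> \<partial>M) - x0)
             < x0 powr p / (1 - p)
               + x0 powr (p - 1) * (p / (1 - p)) * ((\<integral>\<omega>. X T \<omega> \<partial>M) - x0)"
proof -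
  define S where "S = x0 powr p + x0 powr (p - 1) * p * ((\<integral>\<omega>. X T \<omega> \<partial>M) - x0)"
  have "0 \<le> x0 powr (p - 1) * p * ((\<integral>\<omega>. X T \<omega> \<partial>M) - x0)"
    using submartingale_mean_ge[OF X pos(1)] pos by simp
  moreover have "0 < x0 powr p" using pos by simp
  ultimately have S_pos: "0 < S" unfolding S_def by linarith
  have S_div: "x0 powr p / d + x0 powr (p - 1) * (p / d) * ((\<integral>\<omega>. X T \<omega> \<partial>M) - x0) = S / d" for d
    by (simp add: S_def add_divide_distrib)
  have "x0 powr p * (1 - p + p * norm_moment M T x0 X 1) = S"
    using pos norm_moment_one[OF X(1)] by (simp add: S_def powr_diff field_simps)
  then show "x0 powr p * norm_moment M T x0 X p * \<alpha> powr (- p)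
             = x0 powr p / (1 - p + p * \<alpha>)
               + x0 powr (p - 1) * (p / (1 - p + p * \<alpha>)) * ((\<integral>\<omega>. X T \<omega> \<partial>M) - x0)"
    unfolding S_div by (simp add: mult.assoc eq)
  have "S / (1 - p + p * \<alpha>) < S / (1 - p)"
    using S_pos pos \<alpha> by (intro divide_strict_left_mono) (auto intro!: mult_pos_pos add_pos_pos)
  then show "x0 powr p / (1 - p + p * \<alpha>)
               + x0 powr (p - 1) * (p / (1 - p + p * \<alpha>)) * ((\<integral>\<omega>. X T \<omega> \<partial>M) - x0)
             < x0 powr p / (1 - p)
               + x0 powr (p - 1) * (p / (1 - p)) * ((\<integral>\<omega>. X T \<omega> \<partial>M) - x0)"
    unfolding S_div .
qed

lemma (in prob_space) constant_process_sharp: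
  assumes "0 \<le> T" "0 < x0"
  shows "\<exists>X. nonneg_cadlag_from M T x0 X \<and> martingale_on M T X \<and>
        integrable M (\<lambda>\<omega>. running_max X T \<omega> powr p) \<and>
        (\<exists>\<alpha>\<in>{0<..1}.
           norm_moment M T x0 X p * \<alpha> powr (- p)
             = (1 - p + p * norm_moment M T x0 X 1) / (1 - p + p * \<alpha>) \<and>
           (\<integral>\<omega>. running_max X T \<omega> powr p \<partial>M)
             = x0 powr p * norm_moment M T x0 X p * \<alpha> powr (- p))"
proof (intro exI conjI bexI)
  have "norm_moment M T x0 (\<lambda>t \<omega>. x0) r = 1" for r
    using assms by (simp add: norm_moment_def prob_space powr_minus)
  then show "norm_moment M T x0 (\<lambda>t \<omega>. x0) p * 1 powr (- p)
             = (1 - p + p * norm_moment M T x0 (\<lambda>t \<omega>. x0) 1) / (1 - p + p * 1)"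
    "(\<integral>\<omega>. running_max (\<lambda>t \<omega>. x0) T \<omega> powr p \<partial>M)
             = x0 powr p * norm_moment M T x0 (\<lambda>t \<omega>. x0) p * 1 powr (- p)"
    using assms by (simp_all add: constant_process prob_space)
qed (use assms in \<open>simp_all add: constant_process\<close>)

text \<open>
  With \<open>\<delta> = 1 - a T\<close> the gap is exactly \<open>x0^p p / (1 - p)\<close> times \<open>\<delta>^(1-p)\<close>, which
  is non-negative and tends to \<open>0\<close> with \<open>\<delta>\<close>.
\<close>

lemma (in prob_space) killed_process_nearly_sharp:
  assumes U: "U \<in> borel_measurable M" "\<And>\<omega>. \<omega> \<in> space M \<Longrightarrow> 0 < U \<omega>"
      "\<And>u. u \<in> {0..1} \<Longrightarrow> prob {\<omega> \<in> space M. U \<omega> \<le> u} = u"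
    and pos: "0 < T" "0 < x0" "0 < p" "p < 1" "0 < \<epsilon>"
  shows "\<exists>X. nonneg_cadlag_from M T x0 X \<and> martingale_on M T X \<and>
        integrable M (\<lambda>\<omega>. running_max X T \<omega> powr p) \<and>
        0 \<le> x0 powr p / (1 - p)
              + x0 powr (p - 1) * (p / (1 - p)) * ((\<integral>\<omega>. X T \<omega> \<partial>M) - x0)
              - (\<integral>\<omega>. running_max X T \<omega> powr p \<partial>M) \<and>
        x0 powr p / (1 - p)
              + x0 powr (p - 1) * (p / (1 - p)) * ((\<integral>\<omega>. X T \<omega> \<partial>M) - x0)
              - (\<integral>\<omega>. running_max X T \<omega> powr p \<partial>M) < \<epsilon>"
proof -
  define K where "K = x0 powr p * (p / (1 - p))"
  have "((\<lambda>\<delta>::real. K * \<delta> powr (1 - p)) \<longlongrightarrow> K * 0) (at_right 0)"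
    using pos
    by (intro tendsto_mult tendsto_const tendsto_zero_powrI[where b = "1 - p"] tendsto_ident_at)
       (auto simp: eventually_at_filter)
  then have "eventually (\<lambda>\<delta>::real. K * \<delta> powr (1 - p) < \<epsilon>) (at_right 0)"
    using pos by (intro order_tendstoD) auto
  then obtain b :: real where b: "0 < b" "\<And>\<delta>. 0 < \<delta> \<Longrightarrow> \<delta> < b \<Longrightarrow> K * \<delta> powr (1 - p) < \<epsilon>"
    unfolding eventually_at_right_field by blast
  define \<delta> where "\<delta> = min (b / 2) (1 / 2)"
  have \<delta>: "0 < \<delta>" "\<delta> < 1" "K * \<delta> powr (1 - p) < \<epsilon>"
    using b by (auto simp: \<delta>_def)
  define a where "a = (1 - \<delta>) / T"
  have a: "0 < a" "a * T < 1" "1 - a * T = \<delta>" using \<delta> pos by (auto simp: a_def)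
  let ?X = "killed_process x0 a U"
  have mean: "(\<integral>\<omega>. ?X T \<omega> \<partial>M) = x0"
    using a pos U integral_killed_process by simp
  have I: "integrable M (\<lambda>\<omega>. running_max ?X T \<omega> powr p)"
    "(\<integral>\<omega>. running_max ?X T \<omega> powr p \<partial>M)
      = x0 powr p * ((1 - \<delta> powr (1 - p)) / (1 - p) + \<delta> powr (1 - p))"
    using integral_running_max_killed_process[of a T x0 p U] a pos U by simp_all
  have gap: "x0 powr p / (1 - p) + x0 powr (p - 1) * (p / (1 - p)) * ((\<integral>\<omega>. ?X T \<omega> \<partial>M) - x0)
      - (\<integral>\<omega>. running_max ?X T \<omega> powr p \<partial>M) = K * \<delta> powr (1 - p)"
  proof -
    have "(1 - y) / (1 - p) + y = 1 / (1 - p) - p / (1 - p) * y" for y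
      using pos by (simp add: field_simps)
    then show ?thesis
      unfolding I(2) mean K_def by (simp only:) (simp add: right_diff_distrib)
  qed
  show ?thesis
  proof (intro exI[of _ ?X] conjI)
    show "nonneg_cadlag_from M T x0 ?X"
      by (rule nonneg_cadlag_from_killed_process[OF a(1,2) less_imp_le[OF pos(2)] U(2)])
    show "martingale_on M T ?X"
      by (rule martingale_on_killed_process[OF a(1,2) U(1,3)])
  qed (use I(1) gap \<delta> pos in \<open>simp_all add: K_def\<close>)
qed

section \<open>The sharp maximal inequality\<close>

theorem proposition3p4:
  fixes M :: "'a measure" and W :: "real \<Rightarrow> 'a \<Rightarrow> real" and T x0 p :: real
  assumes "prob_space M" and "standard_brownian_motion M W"
    and "0 < T" and "0 < x0" and "0 < p" and "p < 1"
  shows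
    "(\<forall>X. nonneg_cadlag_from M T x0 X \<longrightarrow> submartingale_on M T X \<longrightarrow>
        (\<exists>!\<alpha>. \<alpha> \<in> {0<..1} \<and>
           norm_moment M T x0 X p * \<alpha> powr (- p)
             = (1 - p + p * norm_moment M T x0 X 1) / (1 - p + p * \<alpha>)) \<and>
        (\<forall>\<alpha>\<in>{0<..1}.
           norm_moment M T x0 X p * \<alpha> powr (- p)
             = (1 - p + p * norm_moment M T x0 X 1) / (1 - p + p * \<alpha>) \<longrightarrow>
           integrable M (\<lambda>\<omega>. running_max X T \<omega> powr p) \<and>
           (\<integral>\<omega>. running_max X T \<omega> powr p \<partial>M)
             \<le> x0 powr p * norm_moment M T x0 X p * \<alpha> powr (- p) \<and>
           x0 powr p * norm_moment M T x0 X p * \<alpha> powr (- p)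
             = x0 powr p / (1 - p + p * \<alpha>)
               + x0 powr (p - 1) * (p / (1 - p + p * \<alpha>)) * ((\<integral>\<omega>. X T \<omega> \<partial>M) - x0) \<and>
           x0 powr p / (1 - p + p * \<alpha>)
               + x0 powr (p - 1) * (p / (1 - p + p * \<alpha>)) * ((\<integral>\<omega>. X T \<omega> \<partial>M) - x0)
             < x0 powr p / (1 - p)
               + x0 powr (p - 1) * (p / (1 - p)) * ((\<integral>\<omega>. X T \<omega> \<partial>M) - x0)))
     \<and>
     (\<exists>X. nonneg_cadlag_from M T x0 X \<and> martingale_on M T X \<and>
        integrable M (\<lambda>\<omega>. running_max X T \<omega> powr p) \<and>
        (\<exists>\<alpha>\<in>{0<..1}.
           norm_moment M T x0 X p * \<alpha> powr (- p)
             = (1 - p + p * norm_moment M T x0 X 1) / (1 - p + p * \<alpha>) \<and>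
           (\<integral>\<omega>. running_max X T \<omega> powr p \<partial>M)
             = x0 powr p * norm_moment M T x0 X p * \<alpha> powr (- p)))
     \<and>
     (\<forall>\<epsilon>>0. \<exists>X. nonneg_cadlag_from M T x0 X \<and> martingale_on M T X \<and>
        integrable M (\<lambda>\<omega>. running_max X T \<omega> powr p) \<and>
        0 \<le> x0 powr p / (1 - p)
              + x0 powr (p - 1) * (p / (1 - p)) * ((\<integral>\<omega>. X T \<omega> \<partial>M) - x0)
              - (\<integral>\<omega>. running_max X T \<omega> powr p \<partial>M) \<and>
        x0 powr p / (1 - p)
              + x0 powr (p - 1) * (p / (1 - p)) * ((\<integral>\<omega>. X T \<omega> \<partial>M) - x0)
              - (\<integral>\<omega>. running_max X T \<omega> powr p \<partial>M) < \<epsilon>)"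
proof -
  interpret prob_space M by fact
  have "\<forall>s t. 0 \<le> s \<longrightarrow> s < t \<longrightarrow>
      distributed M lborel (\<lambda>\<omega>. W t \<omega> - W s \<omega>) (normal_density 0 (sqrt (t - s)))"
    using assms(2) unfolding standard_brownian_motion_def by (elim conjE)
  from this[rule_format, of 0 1]
  have "distributed M lborel (\<lambda>\<omega>. W 1 \<omega> - W 0 \<omega>) (normal_density 0 1)"
    by simp
  then obtain U where U: "U \<in> borel_measurable M" "\<And>\<omega>. \<omega> \<in> space M \<Longrightarrow> 0 < U \<omega>"
    "\<And>u. u \<in> {0..1} \<Longrightarrow> prob {\<omega> \<in> space M. U \<omega> \<le> u} = u"
    by (rule uniform_of_positive_density) (auto intro: normal_density_pos)
  note pos = less_imp_le[OF assms(3)] assms(4-6)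
  show ?thesis
    by (intro conjI allI impI ballI
          submartingale_moment_equation_unique[OF _ _ pos]
          submartingale_running_max_bound[OF _ _ pos]
          submartingale_moment_bound_value[OF _ _ pos]
          constant_process_sharp[OF pos(1,2)]
          killed_process_nearly_sharp[OF U assms(3-6)])
qed

end
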